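(* Let $\bar p=(p(1),p(2),\dots)$ be a sequence such that $0<p(i)<1$ for all $i$ and $$\frac{\log\left(\prod_{i=1}^n (1-p(i))\right)}{\log n}\longrightarrow 0\quad\text{as } n\to\infty.$$ Then there exists no procedure (algorithm) which can decide, for each first order sentence $\psi$ from $L$, whether $\lim_{n\to\infty}\mathrm{Prob}(n,\bar p;\psi)=0$ or $\lim_{n\to\infty}\mathrm{Prob}(n,\bar p;\psi)=1$.
   Context: For a sequence $\bar p=(p(1),p(2),\dots)$ with $0\le p(i)\le 1$, $G(n,\bar p)$ is the random graph with vertex set $[n]=\{1,\dots,n\}$ in which each pair of distinct vertices $v,w$ is an edge with probability $p(|v-w|)$, independently for each pair. $L$ is the first order language of graphs: first order logic with equality whose only other predicate is the binary adjacency predicate. $\mathrm{Prob}(n,\bar p;\psi)$ denotes the probability that $G(n,\bar p)$ satisfies the sentence $\psi$. Under the stated hypotheses on $\bar p$, for every sentence $\psi$ from $L$ the limit $\lim_{n\to\infty}\mathrm{Prob}(n,\bar p;\psi)$ exists and is $0$ or $1$. *)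

theory Defs
  imports "HOL-Probability.Probability" "HOL-Library.Nat_Bijection"
begin

section \<open>First order logic of graphs\<close>

text \<open>Variables are named by natural numbers; the remaining connectives and the universal
  quantifier are the usual abbreviations.\<close>

datatype fm =
    Eq nat nat
  | Adj nat nat
  | Neg fm
  | Conj fm fm
  | Ex nat fm

primrec free_vars :: "fm \<Rightarrow> nat set" where
  "free_vars (Eq x y) = {x, y}"
| "free_vars (Adj x y) = {x, y}"
| "free_vars (Neg \<phi>) = free_vars \<phi>"
| "free_vars (Conj \<phi> \<psi>) = free_vars \<phi> \<union> free_vars \<psi>"
| "free_vars (Ex x \<phi>) = free_vars \<phi> - {x}"

definition sentence :: "fm \<Rightarrow> bool" where
  "sentence \<phi> \<longleftrightarrow> free_vars \<phi> = {}"

primrec sat :: "'a set \<Rightarrow> ('a \<Rightarrow> 'a \<Rightarrow> bool) \<Rightarrow> (nat \<Rightarrow> 'a) \<Rightarrow> fm \<Rightarrow> bool" where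
  "sat V E s (Eq x y) \<longleftrightarrow> s x = s y"
| "sat V E s (Adj x y) \<longleftrightarrow> E (s x) (s y)"
| "sat V E s (Neg \<phi>) \<longleftrightarrow> \<not> sat V E s \<phi>"
| "sat V E s (Conj \<phi> \<psi>) \<longleftrightarrow> sat V E s \<phi> \<and> sat V E s \<psi>"
| "sat V E s (Ex x \<phi>) \<longleftrightarrow> (\<exists>a\<in>V. sat V E (s(x := a)) \<phi>)"

definition models :: "'a set \<Rightarrow> ('a \<Rightarrow> 'a \<Rightarrow> bool) \<Rightarrow> fm \<Rightarrow> bool" where
  "models V E \<phi> \<longleftrightarrow> (\<forall>s. (\<forall>x. s x \<in> V) \<longrightarrow> sat V E s \<phi>)"


section \<open>The random graph\<close>

definition vertex_pairs :: "nat \<Rightarrow> (nat \<times> nat) set" where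
  "vertex_pairs n = {(v, w). 1 \<le> v \<and> v < w \<and> w \<le> n}"

text \<open>Finiteness matters: \<open>Pi_pmf\<close> is the independent product only over a finite index set.\<close>

lemma finite_vertex_pairs [simp]: "finite (vertex_pairs n)"
  by (rule finite_subset[of _ "{..n} \<times> {..n}"]) (auto simp: vertex_pairs_def)

text \<open>The outcome is the adjacency relation on \<open>{1..n}\<close>.  It is irreflexive because the
  product takes the default value \<open>False\<close> outside \<open>vertex_pairs n\<close>.\<close>

definition random_graph :: "nat \<Rightarrow> (nat \<Rightarrow> real) \<Rightarrow> (nat \<Rightarrow> nat \<Rightarrow> bool) pmf" where
  "random_graph n p =
     map_pmf (\<lambda>\<omega> v w. \<omega> (min v w, max v w))
       (Pi_pmf (vertex_pairs n) False (\<lambda>(v, w). bernoulli_pmf (p (w - v))))"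

definition Prob :: "nat \<Rightarrow> (nat \<Rightarrow> real) \<Rightarrow> fm \<Rightarrow> real" where
  "Prob n p \<psi> = measure_pmf.prob (random_graph n p) {E. models {1..n} E \<psi>}"


section \<open>Partial recursive functions\<close>

text \<open>Arguments are passed as lists; on inputs of any fixed length the functions given by these
  terms are exactly the partial recursive functions of that arity.\<close>

datatype recf =
    Zero
  | Succ
  | Proj nat
  | Comp recf "recf list"
  | PrimRec recf recf
  | Mu recf

inductive rec_eval :: "recf \<Rightarrow> nat list \<Rightarrow> nat \<Rightarrow> bool" where
  zero: "rec_eval Zero xs 0"
| succ: "rec_eval Succ [x] (Suc x)"
| proj: "i < length xs \<Longrightarrow> rec_eval (Proj i) xs (xs ! i)"
| comp: "list_all2 (\<lambda>g y. rec_eval g xs y) gs ys \<Longrightarrow> rec_eval f ys z \<Longrightarrow>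
         rec_eval (Comp f gs) xs z"
| primrec_zero: "rec_eval f xs y \<Longrightarrow> rec_eval (PrimRec f g) (0 # xs) y"
| primrec_suc: "rec_eval (PrimRec f g) (n # xs) y \<Longrightarrow> rec_eval g (n # y # xs) z \<Longrightarrow>
         rec_eval (PrimRec f g) (Suc n # xs) z"
| mu: "rec_eval f (n # xs) 0 \<Longrightarrow> (\<forall>m<n. \<exists>y. rec_eval f (m # xs) (Suc y)) \<Longrightarrow>
         rec_eval (Mu f) xs n"

inductive_cases rec_eval_ZeroE: "rec_eval Zero xs y"
inductive_cases rec_eval_SuccE: "rec_eval Succ xs y"
inductive_cases rec_eval_ProjE: "rec_eval (Proj i) xs y"
inductive_cases rec_eval_CompE: "rec_eval (Comp f gs) xs y"
inductive_cases rec_eval_PrimRec_0E: "rec_eval (PrimRec f g) (0 # xs) y"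
inductive_cases rec_eval_PrimRec_SucE: "rec_eval (PrimRec f g) (Suc n # xs) y"
inductive_cases rec_eval_MuE: "rec_eval (Mu f) xs y"

lemma rec_eval_deterministic:
  "rec_eval f xs y \<Longrightarrow> rec_eval f xs z \<Longrightarrow> y = z"
proof (induction arbitrary: z rule: rec_eval.induct)
  case (comp xs gs ys f w)
  from comp.prems obtain ys' where ys': "list_all2 (\<lambda>g y. rec_eval g xs y) gs ys'"
    and z: "rec_eval f ys' z"
    by (blast elim: rec_eval_CompE)
  have "ys = ys'"
  proof (rule nth_equalityI)
    show "length ys = length ys'"
      using comp.IH(1) ys' by (simp add: list_all2_conv_all_nth)
    show "ys ! i = ys' ! i" if "i < length ys" for i
      using that comp.IH(1) ys' by (auto simp: list_all2_conv_all_nth)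
  qed
  with z comp.IH(2) show ?case by blast
next
  case (mu f n xs)
  have z: "rec_eval f (z # xs) 0 \<and> (\<forall>m<z. \<exists>y. rec_eval f (m # xs) (Suc y))"
    by (rule rec_eval_MuE[OF mu.prems]) simp
  show ?case
    using z mu.IH by (metis Zero_not_Suc linorder_neqE_nat)
next
  case (primrec_suc f g n xs y w)
  from primrec_suc.prems obtain y' where "rec_eval (PrimRec f g) (n # xs) y'"
    and "rec_eval g (n # y' # xs) z"
    by (blast elim: rec_eval_PrimRec_SucE)
  with primrec_suc.IH show ?case by blast
next
  case zero then show ?case by (blast elim: rec_eval_ZeroE)
next
  case succ then show ?case by (blast elim: rec_eval_SuccE)
next
  case proj then show ?case by (blast elim: rec_eval_ProjE)
next
  case primrec_zero then show ?case by (blast elim: rec_eval_PrimRec_0E)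
qed


section \<open>Decision procedures on sentences\<close>

primrec code_fm :: "fm \<Rightarrow> nat" where
  "code_fm (Eq x y) = prod_encode (0, prod_encode (x, y))"
| "code_fm (Adj x y) = prod_encode (1, prod_encode (x, y))"
| "code_fm (Neg \<phi>) = prod_encode (2, code_fm \<phi>)"
| "code_fm (Conj \<phi> \<psi>) = prod_encode (3, prod_encode (code_fm \<phi>, code_fm \<psi>))"
| "code_fm (Ex x \<phi>) = prod_encode (4, prod_encode (x, code_fm \<phi>))"

lemma code_fm_inject [simp]: "code_fm \<phi> = code_fm \<psi> \<longleftrightarrow> \<phi> = \<psi>"
proof (induction \<phi> arbitrary: \<psi>)
  case (Eq x y) then show ?case by (cases \<psi>) auto
next
  case (Adj x y) then show ?case by (cases \<psi>) auto
next
  case (Neg \<phi>) then show ?case by (cases \<psi>) auto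
next
  case (Conj \<phi>1 \<phi>2) then show ?case by (cases \<psi>) auto
next
  case (Ex x \<phi>) then show ?case by (cases \<psi>) auto
qed

text \<open>A procedure is a partial recursive function reading the code of a sentence.  It answers
  \<open>0\<close> or \<open>1\<close> according to the value of the limit; nothing is required of it, not even
  termination, on numbers that are not codes of sentences.\<close>

definition decides_limit :: "recf \<Rightarrow> (nat \<Rightarrow> real) \<Rightarrow> bool" where
  "decides_limit f p \<longleftrightarrow>
     (\<forall>\<psi>. sentence \<psi> \<longrightarrow>
        ((\<lambda>n. Prob n p \<psi>) \<longlonglongrightarrow> 0 \<longrightarrow> rec_eval f [code_fm \<psi>] 0) \<and>
        ((\<lambda>n. Prob n p \<psi>) \<longlonglongrightarrow> 1 \<longrightarrow> rec_eval f [code_fm \<psi>] 1))"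

end

theory Submission
  imports Defs "HOL-Real_Asymp.Real_Asymp"
begin

text \<open>The proof diagonalises against a supposed decision procedure \<open>f\<close>. A sentence without
nonempty finite models holds in no \<open>G(n, p)\<close> with \<open>n \<ge> 1\<close>, so its limit is \<open>0\<close>. The sentences
used below have the converse property that their limit is \<open>1\<close> as soon as one suitable finite
graph exists, because they speak only about neighbourhoods of a few vertices and because the
random graph contains every finite graph as a union of components
(\<open>prob_isolated_copy_tendsto_1\<close>). Finite satisfiability can express that a computation halts
with a given result, in the manner of Trakhtenbrot.

\<^emph>\<open>Computations in graphs.\<close> Let \<open>v\<close>, \<open>w\<close>, \<open>q\<close> be vertices of a finite graph. The neighbours of \<open>v\<close>
serve as numbers, and they are ordered by inclusion of their neighbourhoods inside the
neighbourhood of \<open>w\<close>. That this is a linear order is a first order condition, and a finite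
linear order is an initial segment of the natural numbers. Any vertex \<open>r\<close> codes the binary
relation of those pairs of numbers that are joined to \<open>r\<close> by a certain pattern of neighbours of
\<open>q\<close>. With binary relations one can write down the course of values of a primitive recursion, so
that each recursive function \<open>f\<close> has a formula \<open>val_fm f\<close> for its graph, which wherever the
numbers are linearly ordered defines the bounded evaluation \<open>bounded_eval\<close> (\<open>sat_val_fm\<close>). A
true instance of that formula, in whatever finite graph, is a true statement about \<open>f\<close>
(\<open>bounded_eval_sound\<close>), and conversely each true value of \<open>f\<close> shows up in the graph \<open>gadgets
N\<close>, which codes every relation on \<open>N\<close> numbers, once \<open>N\<close> is large (\<open>bounded_eval_complete\<close>).

\<^emph>\<open>The diagonal.\<close> Replacing the free variable of a formula \<open>\<phi>\<close> by the number \<open>code_fm \<phi>\<close> gives a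
sentence whose code is a recursive function of the code of \<open>\<phi>\<close> (\<open>rec_eval_diagonal\<close>). Applied to
a formula which says "f answers 0 on the diagonal sentence of x", this yields a sentence \<open>\<psi>\<close>
that has limit \<open>1\<close> if \<open>f\<close> answers \<open>0\<close> on \<open>\<psi>\<close>, and limit \<open>0\<close> otherwise. In both cases \<open>f\<close> is
wrong on \<open>\<psi>\<close>.

\<^emph>\<open>Components of the random graph.\<close> Cut the vertices into disjoint blocks of \<open>k\<close> consecutive ones.
A given block induces the wanted graph and has no edges to the outside with probability at
least \<open>c * (\<Prod>i=1..n. 1 - p i) ^ (2 * k)\<close>, which is \<open>n powr - o(1)\<close> by the hypothesis on \<open>p\<close>,
whereas there are about \<open>n / k\<close> blocks. Two blocks interfere only through the edges between
them, and the same product bounds the number of blocks with which a given block interferes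
noticeably by \<open>o(ln n)\<close>. The second moment method then shows that some block succeeds with
probability tending to \<open>1\<close>.\<close>

section \<open>Evaluating recursive functions below a bound\<close>

text \<open>Two devices replace unbounded search. All intermediate values stay below \<open>N\<close>, and the
course of values of a primitive recursion is guessed as a single relation \<open>R\<close> drawn from the
supply \<open>\<R>\<close>, each of whose pairs has to be justified by a pair with smaller first component. Both
are quantifications that a formula can carry out inside a finite graph. The supply is a
parameter because it depends on the graph in which a formula is evaluated.\<close>

primrec bounded_eval ::
  "nat \<Rightarrow> (nat \<times> nat) set set \<Rightarrow> recf \<Rightarrow> nat list \<Rightarrow> nat \<Rightarrow> bool" where
  "bounded_eval N \<R> Zero is j \<longleftrightarrow> j = 0"
| "bounded_eval N \<R> Succ is j \<longleftrightarrow> (\<exists>i. is = [i] \<and> j = Suc i)"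
| "bounded_eval N \<R> (Proj n) is j \<longleftrightarrow> n < length is \<and> is ! n = j"
| "bounded_eval N \<R> (Comp f gs) is j \<longleftrightarrow>
     (\<exists>js. list_all2 (\<lambda>g l. l < N \<and> g is l) (map (bounded_eval N \<R>) gs) js \<and>
       bounded_eval N \<R> f js j)"
| "bounded_eval N \<R> (PrimRec f g) is j \<longleftrightarrow>
     (\<exists>i is'. is = i # is' \<and> (\<exists>R\<in>\<R>. (i, j) \<in> R \<and>
       (\<forall>a<N. \<forall>b<N. (a, b) \<in> R \<longrightarrow>
         a = 0 \<and> bounded_eval N \<R> f is' b \<or>
         (\<exists>a'<N. \<exists>b'<N. a = Suc a' \<and> (a', b') \<in> R \<and>
           bounded_eval N \<R> g (a' # b' # is') b))))"
| "bounded_eval N \<R> (Mu f) is j \<longleftrightarrow> 0 < N \<and> bounded_eval N \<R> f (j # is) 0 \<and>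
     (\<forall>m<j. \<exists>t. Suc t < N \<and> bounded_eval N \<R> f (m # is) (Suc t))"

text \<open>A justified relation need not be functional, but every pair in it is a true value of the
recursion, by induction on the first component. Hence a poor or even perverse supply of
relations can only lose values and never adds wrong ones.\<close>

lemma bounded_eval_sound:
  assumes "bounded_eval N \<R> f is j" and "\<forall>i\<in>set is. i < N" and "j < N"
  shows "rec_eval f is j"
  using assms
proof (induction f arbitrary: "is" j)
  case Zero
  then show ?case by (simp add: rec_eval.zero)
next
  case Succ
  then show ?case by (auto intro: rec_eval.succ)
next
  case (Proj n)
  then show ?case by (auto intro: rec_eval.proj)
next
  case (Comp f gs)
  from Comp.prems obtain js
    where js: "list_all2 (\<lambda>g l. l < N \<and> g is l) (map (bounded_eval N \<R>) gs) js"
      and f: "bounded_eval N \<R> f js j"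
    by auto
  have "list_all2 (\<lambda>g l. rec_eval g is l) gs js"
    using js Comp.IH(2) Comp.prems(2) by (auto simp: list_all2_conv_all_nth)
  moreover have "\<forall>l\<in>set js. l < N"
    using js by (auto simp: list_all2_conv_all_nth in_set_conv_nth)
  ultimately show ?case
    using Comp.IH(1)[OF f] Comp.prems(3) by (blast intro: rec_eval.comp)
next
  case (PrimRec f g)
  from PrimRec.prems(1) obtain i is' R where "is": "is = i # is'" and ij: "(i, j) \<in> R"
    and R: "\<And>a b. a < N \<Longrightarrow> b < N \<Longrightarrow> (a, b) \<in> R \<Longrightarrow>
      a = 0 \<and> bounded_eval N \<R> f is' b \<or>
      (\<exists>a'<N. \<exists>b'<N. a = Suc a' \<and> (a', b') \<in> R \<and> bounded_eval N \<R> g (a' # b' # is') b)"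
    by auto
  have is': "\<forall>i\<in>set is'. i < N"
    using PrimRec.prems(2) "is" by simp
  have "rec_eval (PrimRec f g) (a # is') b" if "a < N" "b < N" "(a, b) \<in> R" for a b
    using that
  proof (induction a arbitrary: b)
    case 0
    then show ?case
      using R[of 0 b] PrimRec.IH(1)[of is' b] is' by (auto intro: rec_eval.primrec_zero)
  next
    case (Suc a)
    from R[OF Suc.prems] obtain b' where b': "a < N" "b' < N" "(a, b') \<in> R"
      and g: "bounded_eval N \<R> g (a # b' # is') b"
      by auto
    have "rec_eval g (a # b' # is') b"
      by (rule PrimRec.IH(2)[OF g]) (use b' is' Suc.prems in auto)
    with Suc.IH[OF b'] show ?case
      by (blast intro: rec_eval.primrec_suc)
  qed
  with ij "is" PrimRec.prems show ?case by auto
next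
  case (Mu f)
  show ?case
  proof (rule rec_eval.mu)
    show "rec_eval f (j # is) 0"
      using Mu.IH[of "j # is" 0] Mu.prems by auto
    show "\<forall>m<j. \<exists>t. rec_eval f (m # is) (Suc t)"
    proof (intro allI impI)
      fix m assume "m < j"
      then obtain t where "Suc t < N" "bounded_eval N \<R> f (m # is) (Suc t)"
        using Mu.prems by auto
      then show "\<exists>t. rec_eval f (m # is) (Suc t)"
        using Mu.IH[of "m # is" "Suc t"] Mu.prems \<open>m < j\<close> by auto
    qed
  qed
qed

lemma rec_eval_PrimRecD:
  assumes "rec_eval (PrimRec f g) xs y"
  obtains n ys c where "xs = n # ys" "c n = y" "rec_eval f ys (c 0)"
    "\<And>i. i < n \<Longrightarrow> rec_eval g (i # c i # ys) (c (Suc i))"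
proof -
  have "\<exists>n ys c. xs = n # ys \<and> c n = y \<and> rec_eval f ys (c 0) \<and>
      (\<forall>i<n. rec_eval g (i # c i # ys) (c (Suc i)))"
    using assms
  proof (induction "PrimRec f g" xs y rule: rec_eval.induct)
    case (primrec_zero xs y)
    then show ?case by (intro exI[of _ 0] exI[of _ xs] exI[of _ "\<lambda>_. y"]) simp
  next
    case (primrec_suc n xs y z)
    then obtain c where c: "c n = y" "rec_eval f xs (c 0)"
      "\<forall>i<n. rec_eval g (i # c i # xs) (c (Suc i))"
      by auto
    show ?case
      using c primrec_suc
      by (intro exI[of _ "Suc n"] exI[of _ xs] exI[of _ "c(Suc n := z)"]) (auto simp: less_Suc_eq)
  qed
  then show thesis using that by blast
qed

text \<open>Each evaluation involves only finitely many numbers and relations, so it survives the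
bound as soon as \<open>N\<close> exceeds these numbers and all relations below \<open>N\<close> are in supply. Stating
this as a property of all large \<open>N\<close> lets the finitely many subcomputations share one bound.\<close>

lemma bounded_eval_complete:
  assumes "rec_eval f is j"
  shows "\<forall>\<^sub>F N in sequentially. bounded_eval N (Pow ({..<N} \<times> {..<N})) f is j"
  using assms
proof (induction f arbitrary: "is" j)
  case Zero
  then show ?case by (auto elim: rec_eval_ZeroE)
next
  case Succ
  then show ?case by (auto elim: rec_eval_SuccE)
next
  case (Proj n)
  then show ?case by (auto elim: rec_eval_ProjE)
next
  case (Comp f gs)
  from Comp.prems obtain js where js: "list_all2 (\<lambda>g l. rec_eval g is l) gs js"
    and f: "rec_eval f js j"
    by (auto elim: rec_eval_CompE)
  have "\<forall>\<^sub>F N in sequentially. \<forall>n\<in>{..<length gs}. js ! n < N \<and>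
      bounded_eval N (Pow ({..<N} \<times> {..<N})) (gs ! n) is (js ! n)"
    using js by (intro eventually_ball_finite ballI eventually_conj eventually_gt_at_top Comp.IH(2))
      (auto simp: list_all2_conv_all_nth)
  with Comp.IH(1)[OF f] show ?case
  proof eventually_elim
    case (elim N)
    then show ?case
      using js by (auto simp: list_all2_conv_all_nth intro!: exI[of _ js])
  qed
next
  case (PrimRec f g)
  from PrimRec.prems obtain n ns c where "is": "is = n # ns" and j: "c n = j"
    and c0: "rec_eval f ns (c 0)"
    and cS: "\<And>i. i < n \<Longrightarrow> rec_eval g (i # c i # ns) (c (Suc i))"
    by (rule rec_eval_PrimRecD) blast
  have "\<forall>\<^sub>F N in sequentially. \<forall>i\<in>{..<n}.
      bounded_eval N (Pow ({..<N} \<times> {..<N})) g (i # c i # ns) (c (Suc i))"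
    by (intro eventually_ball_finite ballI PrimRec.IH(2) cS) auto
  moreover have "\<forall>\<^sub>F N in sequentially. \<forall>i\<in>{..n}. c i < N"
    by (intro eventually_ball_finite ballI eventually_gt_at_top) auto
  ultimately show ?case
    using PrimRec.IH(1)[OF c0] eventually_gt_at_top[of n]
  proof eventually_elim
    case (elim N)
    \<comment> \<open>The guessed relation is the graph of the course of values \<open>c\<close>.\<close>
    let ?R = "(\<lambda>i. (i, c i)) ` {..n}"
    have R: "?R \<in> Pow ({..<N} \<times> {..<N})"
      using elim by auto
    have step: "a = 0 \<and> bounded_eval N (Pow ({..<N} \<times> {..<N})) f ns b \<or>
        (\<exists>a'<N. \<exists>b'<N. a = Suc a' \<and> (a', b') \<in> ?R \<and>
          bounded_eval N (Pow ({..<N} \<times> {..<N})) g (a' # b' # ns) b)"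
      if "(a, b) \<in> ?R" for a b
    proof (cases a)
      case 0
      then show ?thesis using that elim by auto
    next
      case (Suc a')
      with that have a': "a' < n" and b: "b = c a" by auto
      have "(a', c a') \<in> ?R" using a' by auto
      moreover have "a' < N" "c a' < N" using a' elim by auto
      ultimately show ?thesis using a' b Suc elim by blast
    qed
    have "(n, j) \<in> ?R"
      using j by auto
    with R step show ?case
      unfolding "is" bounded_eval.simps
      by (intro exI[of _ n] exI[of _ ns] conjI bexI[of _ ?R] refl allI impI) simp_all
  qed
next
  case (Mu f)
  from Mu.prems have f0: "rec_eval f (j # is) 0"
    and "\<And>m. m < j \<Longrightarrow> \<exists>t. rec_eval f (m # is) (Suc t)"
    by (auto elim: rec_eval_MuE)
  then obtain t where t: "\<And>m. m < j \<Longrightarrow> rec_eval f (m # is) (Suc (t m))"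
    by metis
  have "\<forall>\<^sub>F N in sequentially. \<forall>m\<in>{..<j}. Suc (t m) < N \<and>
      bounded_eval N (Pow ({..<N} \<times> {..<N})) f (m # is) (Suc (t m))"
    by (intro eventually_ball_finite ballI eventually_conj eventually_gt_at_top Mu.IH t) auto
  with Mu.IH[OF f0] eventually_gt_at_top[of 0] show ?case
    by eventually_elim auto
qed

section \<open>Formulas about numbers in a graph\<close>

text \<open>The variables \<open>0\<close>, \<open>1\<close>, \<open>2\<close> are reserved for the roots \<open>v\<close>, \<open>w\<close>, \<open>q\<close>. The numbers are the
neighbours of \<open>v\<close>, and the quantifiers \<open>num_ex\<close> and \<open>num_all\<close> range over them. Bound variables
of the formulas of this section are chosen above all other variables in sight and never below
\<open>3\<close>, so that they capture nothing.\<close>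

definition num_ex :: "nat \<Rightarrow> fm \<Rightarrow> fm" where
  "num_ex x \<phi> = Ex x (Conj (Adj 0 x) \<phi>)"

definition num_all :: "nat \<Rightarrow> fm \<Rightarrow> fm" where
  "num_all x \<phi> = Neg (num_ex x (Neg \<phi>))"

definition imp_fm :: "fm \<Rightarrow> fm \<Rightarrow> fm" where
  "imp_fm \<phi> \<psi> = Neg (Conj \<phi> (Neg \<psi>))"

definition disj_fm :: "fm \<Rightarrow> fm \<Rightarrow> fm" where
  "disj_fm \<phi> \<psi> = Neg (Conj (Neg \<phi>) (Neg \<psi>))"

definition false_fm :: fm where
  "false_fm = Neg (Eq 0 0)"

definition conjs_fm :: "fm list \<Rightarrow> fm" where
  "conjs_fm \<phi>s = foldr Conj \<phi>s (Eq 0 0)"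

definition le_fm :: "nat \<Rightarrow> nat \<Rightarrow> fm" where
  "le_fm x y = (let u = x + y + 3 in
     Neg (Ex u (Conj (Adj 1 u) (Conj (Adj x u) (Neg (Adj y u))))))"

definition zero_fm :: "nat \<Rightarrow> fm" where
  "zero_fm x = num_all (x + 3) (le_fm x (x + 3))"

definition succ_fm :: "nat \<Rightarrow> nat \<Rightarrow> fm" where
  "succ_fm x y = (let z = x + y + 3 in
     Conj (Neg (le_fm y x)) (num_all z (disj_fm (le_fm z x) (le_fm y z))))"

text \<open>An ordered pair needs an asymmetric pattern in an undirected graph: the first component
is attached to the neighbour \<open>c\<close> of \<open>r\<close> and \<open>q\<close>, the second one to a further neighbour \<open>d\<close> of
\<open>c\<close>.\<close>

definition pair_fm :: "nat \<Rightarrow> nat \<Rightarrow> nat \<Rightarrow> fm" where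
  "pair_fm r x y = (let c = r + x + y + 3; d = r + x + y + 4 in
     Ex c (Ex d (Conj (Adj 2 c) (Conj (Adj r c)
       (Conj (Adj c x) (Conj (Adj c d) (Adj d y)))))))"

primrec num_exs :: "nat list \<Rightarrow> fm \<Rightarrow> fm" where
  "num_exs [] \<phi> = \<phi>"
| "num_exs (x # xs) \<phi> = num_ex x (num_exs xs \<phi>)"

text \<open>\<open>val_fm f xs y k\<close> says that \<open>f\<close> maps the values of the variables \<open>xs\<close> to the value of \<open>y\<close>,
using bound variables from \<open>k\<close> on. The explicit supply \<open>k\<close> of fresh variables makes renaming
superfluous. Each clause transcribes the corresponding clause of \<open>bounded_eval\<close>.\<close>

primrec val_fm :: "recf \<Rightarrow> nat list \<Rightarrow> nat \<Rightarrow> nat \<Rightarrow> fm" where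
  "val_fm Zero xs y k = zero_fm y"
| "val_fm Succ xs y k = (case xs of [x] \<Rightarrow> succ_fm x y | _ \<Rightarrow> false_fm)"
| "val_fm (Proj i) xs y k = (if i < length xs then Eq (xs ! i) y else false_fm)"
| "val_fm (Comp f gs) xs y k =
     (let zs = [k..<k + length gs]; k' = k + length gs in
      num_exs zs (Conj (conjs_fm (map (\<lambda>(g, z). g xs z k') (zip (map val_fm gs) zs)))
                       (val_fm f zs y k')))"
| "val_fm (PrimRec f g) xs y k =
     (case xs of [] \<Rightarrow> false_fm | x # xs' \<Rightarrow>
       Ex k (Conj (pair_fm k x y)
         (num_all (k + 1) (num_all (k + 2) (imp_fm (pair_fm k (k + 1) (k + 2))
           (disj_fm (Conj (zero_fm (k + 1)) (val_fm f xs' (k + 2) (k + 3)))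
             (num_ex (k + 3) (num_ex (k + 4) (Conj (succ_fm (k + 3) (k + 1))
               (Conj (pair_fm k (k + 3) (k + 4))
                 (val_fm g ((k + 3) # (k + 4) # xs') (k + 2) (k + 5))))))))))))"
| "val_fm (Mu f) xs y k =
     Conj (num_ex k (Conj (zero_fm k) (val_fm f (y # xs) k (k + 1))))
       (num_all k (disj_fm (le_fm y k)
         (num_ex (k + 1) (num_ex (k + 2)
           (Conj (succ_fm (k + 2) (k + 1)) (val_fm f (k # xs) (k + 1) (k + 3)))))))"

definition le_via :: "'a set \<Rightarrow> ('a \<Rightarrow> 'a \<Rightarrow> bool) \<Rightarrow> 'a \<Rightarrow> 'a \<Rightarrow> 'a \<Rightarrow> bool" where
  "le_via V E w x y \<longleftrightarrow> (\<forall>u\<in>V. E w u \<longrightarrow> E x u \<longrightarrow> E y u)"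

definition coded_pair ::
  "'a set \<Rightarrow> ('a \<Rightarrow> 'a \<Rightarrow> bool) \<Rightarrow> 'a \<Rightarrow> 'a \<Rightarrow> 'a \<Rightarrow> 'a \<Rightarrow> bool" where
  "coded_pair V E q r x y \<longleftrightarrow> (\<exists>c\<in>V. \<exists>d\<in>V. E q c \<and> E r c \<and> E c x \<and> E c d \<and> E d y)"

lemma sat_connectives [simp]:
  "sat V E s (imp_fm \<phi> \<psi>) \<longleftrightarrow> (sat V E s \<phi> \<longrightarrow> sat V E s \<psi>)"
  "sat V E s (disj_fm \<phi> \<psi>) \<longleftrightarrow> (sat V E s \<phi> \<or> sat V E s \<psi>)"
  "\<not> sat V E s false_fm"
  by (auto simp: imp_fm_def disj_fm_def false_fm_def)

lemma sat_conjs_fm [simp]: "sat V E s (conjs_fm \<phi>s) \<longleftrightarrow> (\<forall>\<phi>\<in>set \<phi>s. sat V E s \<phi>)"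
  by (induction \<phi>s) (auto simp: conjs_fm_def)

lemma sat_le_fm [simp]: "sat V E s (le_fm x y) \<longleftrightarrow> le_via V E (s 1) (s x) (s y)"
  by (auto simp: le_fm_def le_via_def Let_def)

lemma sat_pair_fm [simp]:
  "sat V E s (pair_fm r x y) \<longleftrightarrow> coded_pair V E (s 2) (s r) (s x) (s y)"
  by (simp add: pair_fm_def coded_pair_def Let_def)

lemma free_vars_simps [simp]:
  "free_vars (num_ex x \<phi>) = insert 0 (free_vars \<phi>) - {x}"
  "free_vars (num_all x \<phi>) = insert 0 (free_vars \<phi>) - {x}"
  "free_vars (imp_fm \<phi> \<psi>) = free_vars \<phi> \<union> free_vars \<psi>"
  "free_vars (disj_fm \<phi> \<psi>) = free_vars \<phi> \<union> free_vars \<psi>"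
  "free_vars false_fm = {0}"
  "free_vars (le_fm x y) = {1, x, y}"
  "free_vars (zero_fm x) = {0, 1, x}"
  "free_vars (succ_fm x y) = {0, 1, x, y}"
  "free_vars (pair_fm r x y) = {2, r, x, y}"
  by (auto simp: num_ex_def num_all_def imp_fm_def disj_fm_def false_fm_def
      le_fm_def zero_fm_def succ_fm_def pair_fm_def Let_def)

lemma free_vars_conjs_fm [simp]:
  "free_vars (conjs_fm \<phi>s) = insert 0 (\<Union>\<phi>\<in>set \<phi>s. free_vars \<phi>)"
  by (induction \<phi>s) (auto simp: conjs_fm_def)

lemma free_vars_num_exs: "free_vars (num_exs xs \<phi>) \<subseteq> insert 0 (free_vars \<phi> - set xs)"
  by (induction xs) auto

lemma free_vars_val_fm: "free_vars (val_fm f xs y k) \<subseteq> {0, 1, 2, y} \<union> set xs"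
proof (induction f arbitrary: xs y k)
  case Zero
  then show ?case by auto
next
  case Succ
  then show ?case by (auto split: list.splits)
next
  case (Proj i)
  then show ?case by auto
next
  case (Comp f gs)
  have gs: "free_vars \<phi> \<subseteq> {0, 1, 2} \<union> set xs \<union> {k..<k + length gs}"
    if "\<phi> \<in> set (map (\<lambda>(g, z). g xs z (k + length gs)) (zip (map val_fm gs) [k..<k + length gs]))"
    for \<phi>
  proof -
    from that obtain i where i: "i < length gs"
      and \<phi>: "\<phi> = val_fm (gs ! i) xs (k + i) (k + length gs)"
      by (auto simp: in_set_conv_nth)
    have "free_vars \<phi> \<subseteq> {0, 1, 2, k + i} \<union> set xs"
      unfolding \<phi> by (rule Comp.IH) (use i in simp)
    with i show ?thesis by auto
  qed
  have f: "free_vars (val_fm f [k..<k + length gs] y (k + length gs))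
      \<subseteq> {0, 1, 2, y} \<union> {k..<k + length gs}"
    using Comp.IH(1)[of "[k..<k + length gs]" y "k + length gs"] by simp
  show ?case
    unfolding val_fm.simps Let_def
    by (rule order_trans[OF free_vars_num_exs]) (use gs f in auto)
next
  case (PrimRec f g)
  show ?case
  proof (cases xs)
    case Nil
    then show ?thesis by simp
  next
    case (Cons x xs')
    have f: "free_vars (val_fm f xs' (k + 2) (k + 3)) \<subseteq> {0, 1, 2, k + 2} \<union> set xs'"
      by (rule PrimRec.IH)
    have g: "free_vars (val_fm g ((k + 3) # (k + 4) # xs') (k + 2) (k + 5))
        \<subseteq> {0, 1, 2, k + 2, k + 3, k + 4} \<union> set xs'"
      using PrimRec.IH(2)[of "(k + 3) # (k + 4) # xs'" "k + 2" "k + 5"] by auto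
    show ?thesis
      unfolding Cons val_fm.simps list.case free_vars.simps free_vars_simps list.set
      using f g by blast
  qed
next
  case (Mu f)
  have "free_vars (val_fm f (y # xs) k (k + 1)) \<subseteq> {0, 1, 2, y, k} \<union> set xs"
    using Mu.IH[of "y # xs" k "k + 1"] by auto
  moreover have "free_vars (val_fm f (k # xs) (k + 1) (k + 3)) \<subseteq> {0, 1, 2, k, k + 1} \<union> set xs"
    using Mu.IH[of "k # xs" "k + 1" "k + 3"] by auto
  ultimately show ?case
    unfolding val_fm.simps free_vars.simps free_vars_simps by blast
qed

lemma sat_cong:
  assumes "\<And>x. x \<in> free_vars \<phi> \<Longrightarrow> s x = t x"
  shows "sat V E s \<phi> \<longleftrightarrow> sat V E t \<phi>"
  using assms
proof (induction \<phi> arbitrary: s t)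
  case (Ex x \<phi>)
  have "sat V E (s(x := a)) \<phi> \<longleftrightarrow> sat V E (t(x := a)) \<phi>" for a
    by (rule Ex.IH) (use Ex.prems in auto)
  then show ?case by simp
next
  case (Conj \<phi> \<psi>)
  show ?case
    using Conj.IH(1)[of s t] Conj.IH(2)[of s t] Conj.prems by simp
next
  case (Neg \<phi>)
  show ?case
    using Neg.IH[of s t] Neg.prems by simp
qed simp_all

text \<open>A graph in which the neighbours of \<open>v\<close> form an initial segment of the natural numbers,
with \<open>num\<close> as enumeration. The vertex \<open>q\<close> determines which relations are coded.\<close>

locale number_graph =
  fixes V :: "'a set" and E :: "'a \<Rightarrow> 'a \<Rightarrow> bool" and v w q :: 'a
    and N :: nat and num :: "nat \<Rightarrow> 'a"
  assumes bij_num: "bij_betw num {..<N} {x\<in>V. E v x}"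
    and le_via_num: "\<And>i j. i < N \<Longrightarrow> j < N \<Longrightarrow> le_via V E w (num i) (num j) \<longleftrightarrow> i \<le> j"
begin

lemma num_eq_iff: "i < N \<Longrightarrow> j < N \<Longrightarrow> num i = num j \<longleftrightarrow> i = j"
  using bij_num by (auto simp: bij_betw_def inj_on_def)

lemma sat_num_ex:
  "s 0 = v \<Longrightarrow> 0 < x \<Longrightarrow> sat V E s (num_ex x \<phi>) \<longleftrightarrow> (\<exists>i<N. sat V E (s(x := num i)) \<phi>)"
proof -
  assume *: "s 0 = v" "0 < x"
  have "sat V E s (num_ex x \<phi>) \<longleftrightarrow> (\<exists>a\<in>{x\<in>V. E v x}. sat V E (s(x := a)) \<phi>)"
    using * by (auto simp: num_ex_def)
  also have "{x\<in>V. E v x} = num ` {..<N}"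
    using bij_num by (simp add: bij_betw_def)
  also have "(\<exists>a\<in>num ` {..<N}. P a) \<longleftrightarrow> (\<exists>i<N. P (num i))" for P
    by auto
  finally show ?thesis .
qed

lemma sat_num_all:
  "s 0 = v \<Longrightarrow> 0 < x \<Longrightarrow> sat V E s (num_all x \<phi>) \<longleftrightarrow> (\<forall>i<N. sat V E (s(x := num i)) \<phi>)"
  by (simp add: num_all_def sat_num_ex)

definition at_roots :: "(nat \<Rightarrow> 'a) \<Rightarrow> bool" where
  "at_roots s \<longleftrightarrow> s 0 = v \<and> s 1 = w \<and> s 2 = q"

lemma at_roots_upd [simp]: "3 \<le> x \<Longrightarrow> at_roots (s(x := a)) \<longleftrightarrow> at_roots s"
  by (auto simp: at_roots_def)

definition denotes :: "(nat \<Rightarrow> 'a) \<Rightarrow> nat \<Rightarrow> nat \<Rightarrow> bool" where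
  "denotes s x i \<longleftrightarrow> i < N \<and> s x = num i"

lemma denotes_upd [simp]:
  "denotes (s(x := num i)) x j \<longleftrightarrow> i = j \<and> i < N" if "i < N"
  using that num_eq_iff by (auto simp: denotes_def)

lemma denotes_upd_other [simp]: "x \<noteq> y \<Longrightarrow> denotes (s(x := a)) y j \<longleftrightarrow> denotes s y j"
  by (auto simp: denotes_def)

lemma sat_zero_fm:
  "at_roots s \<Longrightarrow> denotes s x i \<Longrightarrow> sat V E s (zero_fm x) \<longleftrightarrow> i = 0"
  by (auto simp: zero_fm_def sat_num_all at_roots_def denotes_def le_via_num)

lemma sat_succ_fm:
  assumes "at_roots s" "denotes s x i" "denotes s y j"
  shows "sat V E s (succ_fm x y) \<longleftrightarrow> j = Suc i"
proof -
  have "sat V E s (succ_fm x y) \<longleftrightarrow> i < j \<and> (\<forall>l<N. l \<le> i \<or> j \<le> l)"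
    using assms by (auto simp: succ_fm_def Let_def sat_num_all at_roots_def denotes_def le_via_num)
  also have "\<dots> \<longleftrightarrow> j = Suc i"
    using assms by (auto simp: denotes_def dest: spec[of _ "Suc i"])
  finally show ?thesis .
qed

lemma sat_le_fm_num:
  assumes "at_roots s" "denotes s x i" "denotes s y j"
  shows "sat V E s (le_fm x y) \<longleftrightarrow> i \<le> j"
  using assms by (auto simp: at_roots_def denotes_def le_via_num)


definition relations :: "(nat \<times> nat) set set" where
  "relations = (\<lambda>r. {(i, j). i < N \<and> j < N \<and> coded_pair V E q r (num i) (num j)}) ` V"

text \<open>A block of existential quantifiers over consecutive variables, as it occurs in the clause
for composition, is one choice of an assignment that differs from \<open>s\<close> only on that block.\<close>

lemma sat_num_exs:
  assumes "at_roots s" "3 \<le> k"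
  shows "sat V E s (num_exs [k..<k + n] \<phi>) \<longleftrightarrow>
    (\<exists>js t. list_all2 (denotes t) [k..<k + n] js \<and> (\<forall>x. x < k \<or> k + n \<le> x \<longrightarrow> t x = s x) \<and> sat V E t \<phi>)"
  using assms
proof (induction n arbitrary: k s)
  case 0
  have "(\<forall>x. x < k \<or> k + 0 \<le> x \<longrightarrow> t x = s x) \<longleftrightarrow> t = s" for t
    by (auto simp: fun_eq_iff not_less)
  then show ?case by simp
next
  case (Suc n)
  have upt: "[k..<k + Suc n] = k # [Suc k..<Suc k + n]"
    by (simp add: upt_conv_Cons)
  have "sat V E s (num_exs [k..<k + Suc n] \<phi>) \<longleftrightarrow>
      (\<exists>i<N. sat V E (s(k := num i)) (num_exs [Suc k..<Suc k + n] \<phi>))"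
    unfolding upt using Suc.prems by (simp add: sat_num_ex at_roots_def)
  also have "\<dots> \<longleftrightarrow> (\<exists>i<N. \<exists>js t. list_all2 (denotes t) [Suc k..<Suc k + n] js \<and>
      (\<forall>x. x < Suc k \<or> Suc k + n \<le> x \<longrightarrow> t x = (s(k := num i)) x) \<and> sat V E t \<phi>)"
    using Suc.prems by (subst Suc.IH) simp_all
  also have "\<dots> \<longleftrightarrow> (\<exists>js t. list_all2 (denotes t) [k..<k + Suc n] js \<and>
      (\<forall>x. x < k \<or> k + Suc n \<le> x \<longrightarrow> t x = s x) \<and> sat V E t \<phi>)" (is "?L \<longleftrightarrow> ?R")
  proof
    assume ?L
    then obtain i js t where "i < N" "list_all2 (denotes t) [Suc k..<Suc k + n] js"
      and t: "\<And>x. x < Suc k \<or> Suc k + n \<le> x \<Longrightarrow> t x = (s(k := num i)) x" and "sat V E t \<phi>"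
      by blast
    moreover from this have "denotes t k i"
      by (simp add: denotes_def)
    ultimately show ?R
      unfolding upt by (intro exI[of _ "i # js"] exI[of _ t]) auto
  next
    assume ?R
    then obtain i js t where i: "denotes t k i" and js: "list_all2 (denotes t) [Suc k..<Suc k + n] js"
      and t: "\<And>x. x < k \<or> k + Suc n \<le> x \<Longrightarrow> t x = s x" and \<phi>: "sat V E t \<phi>"
      unfolding upt by (auto simp: list_all2_Cons1)
    show ?L
    proof (intro exI conjI allI impI)
      show "i < N" using i by (simp add: denotes_def)
      show "t x = (s(k := num i)) x" if "x < Suc k \<or> Suc k + n \<le> x" for x
        using that t[of x] i by (auto simp: denotes_def)
    qed (use js \<phi> in auto)
  qed
  finally show ?case .
qed

lemma denotes_eq_iff: "denotes s x i \<Longrightarrow> denotes s y j \<Longrightarrow> s x = s y \<longleftrightarrow> i = j"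
  by (simp add: denotes_def num_eq_iff)

lemma list_all2_denotes_cong:
  "(\<And>x. x \<in> set xs \<Longrightarrow> s x = t x) \<Longrightarrow> list_all2 (denotes s) xs is \<longleftrightarrow> list_all2 (denotes t) xs is"
  by (auto simp: list_all2_conv_all_nth denotes_def)

text \<open>The formula for \<open>f\<close> means bounded evaluation of \<open>f\<close>, with the relations that the vertices
of the graph happen to code as supply. The induction keeps all variables in use below \<open>k\<close>, so
the updates made for the bound variables leave their values untouched.\<close>

lemma sat_val_fm:
  assumes "at_roots s" "3 \<le> k" "\<forall>x\<in>set xs. x < k" "y < k"
    and "list_all2 (denotes s) xs is" "denotes s y j"
  shows "sat V E s (val_fm f xs y k) \<longleftrightarrow> bounded_eval N relations f is j"
  using assms
proof (induction f arbitrary: s xs y k "is" j)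
  case Zero
  then show ?case by (simp add: sat_zero_fm)
next
  case Succ
  show ?case
  proof (cases "\<exists>x. xs = [x]")
    case True
    with Succ.prems show ?thesis
      by (auto simp: list_all2_Cons1 sat_succ_fm)
  next
    case False
    then have "\<not> (\<exists>i. is = [i])"
      using Succ.prems(5) by (auto simp: list_all2_Cons2)
    with False show ?thesis
      by (auto split: list.splits)
  qed
next
  case (Proj n)
  then show ?case
    using denotes_eq_iff[of s "xs ! n" "is ! n" y j] by (auto simp: list_all2_conv_all_nth)
next
  case (Comp f gs)
  let ?n = "length gs"
  let ?zs = "[k..<k + ?n]"
  have *: "sat V E t (conjs_fm (map (\<lambda>(g, z). g xs z (k + ?n)) (zip (map val_fm gs) ?zs))) \<and>
        sat V E t (val_fm f ?zs y (k + ?n)) \<longleftrightarrow>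
      list_all2 (\<lambda>g l. l < N \<and> g is l) (map (bounded_eval N relations) gs) js \<and>
        bounded_eval N relations f js j"
    if js: "list_all2 (denotes t) ?zs js" and t: "\<forall>x. x < k \<or> k + ?n \<le> x \<longrightarrow> t x = s x" for t js
  proof -
    have len: "length js = ?n" and js_nth: "\<And>n. n < ?n \<Longrightarrow> denotes t (k + n) (js ! n)"
      using js by (auto simp: list_all2_conv_all_nth)
    have "list_all2 (denotes t) xs is \<longleftrightarrow> list_all2 (denotes s) xs is"
      by (rule list_all2_denotes_cong) (use t Comp.prems in auto)
    then have t': "at_roots t" "list_all2 (denotes t) xs is" "denotes t y j"
      using Comp.prems t by (auto simp: at_roots_def denotes_def)
    have "sat V E t (val_fm (gs ! n) xs (k + n) (k + ?n)) \<longleftrightarrow>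
        bounded_eval N relations (gs ! n) is (js ! n)" if "n < ?n" for n
      by (rule Comp.IH(2)) (use that t' js_nth Comp.prems in auto)
    moreover have "map (\<lambda>(g, z). g xs z (k + ?n)) (zip (map val_fm gs) ?zs) =
        map (\<lambda>n. val_fm (gs ! n) xs (k + n) (k + ?n)) [0..<?n]"
      by (rule nth_equalityI) auto
    ultimately have "sat V E t (conjs_fm (map (\<lambda>(g, z). g xs z (k + ?n)) (zip (map val_fm gs) ?zs))) \<longleftrightarrow>
        (\<forall>n<?n. bounded_eval N relations (gs ! n) is (js ! n))"
      by auto
    also have "\<dots> \<longleftrightarrow> list_all2 (\<lambda>g l. l < N \<and> g is l) (map (bounded_eval N relations) gs) js"
      using len js_nth by (auto simp: list_all2_conv_all_nth denotes_def)
    finally have "sat V E t (conjs_fm (map (\<lambda>(g, z). g xs z (k + ?n)) (zip (map val_fm gs) ?zs))) \<longleftrightarrow>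
        list_all2 (\<lambda>g l. l < N \<and> g is l) (map (bounded_eval N relations) gs) js" .
    moreover have "sat V E t (val_fm f ?zs y (k + ?n)) \<longleftrightarrow> bounded_eval N relations f js j"
      by (rule Comp.IH(1)) (use t' js Comp.prems in auto)
    ultimately show ?thesis by (simp only:)
  qed
  have ex: "\<exists>t. list_all2 (denotes t) ?zs js \<and> (\<forall>x. x < k \<or> k + ?n \<le> x \<longrightarrow> t x = s x)"
    if "list_all2 (\<lambda>g l. l < N \<and> g is l) (map (bounded_eval N relations) gs) js" for js
    using that
    by (intro exI[of _ "\<lambda>x. if x < k \<or> k + ?n \<le> x then s x else num (js ! (x - k))"])
      (auto simp: list_all2_conv_all_nth denotes_def)
  have "sat V E s (val_fm (Comp f gs) xs y k) \<longleftrightarrow>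
    (\<exists>js t. list_all2 (denotes t) ?zs js \<and> (\<forall>x. x < k \<or> k + ?n \<le> x \<longrightarrow> t x = s x) \<and>
      sat V E t (conjs_fm (map (\<lambda>(g, z). g xs z (k + ?n)) (zip (map val_fm gs) ?zs))) \<and>
        sat V E t (val_fm f ?zs y (k + ?n)))"
    using Comp.prems by (simp only: val_fm.simps Let_def sat_num_exs sat.simps)
  also have "\<dots> \<longleftrightarrow> (\<exists>js t. list_all2 (denotes t) ?zs js \<and> (\<forall>x. x < k \<or> k + ?n \<le> x \<longrightarrow> t x = s x) \<and>
      list_all2 (\<lambda>g l. l < N \<and> g is l) (map (bounded_eval N relations) gs) js \<and>
        bounded_eval N relations f js j)"
    using * by (simp cong: conj_cong del: val_fm.simps bounded_eval.simps list_all2_map1 upt_conv_Cons_Cons)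
  also have "\<dots> \<longleftrightarrow> bounded_eval N relations (Comp f gs) is j"
    unfolding bounded_eval.simps using ex by blast
  finally show ?case .
next
  case (PrimRec f g)
  show ?case
  proof (cases xs)
    case Nil
    with PrimRec.prems show ?thesis by simp
  next
    case (Cons x xs')
    then obtain i is' where "is": "is = i # is'" and i: "denotes s x i" and is': "list_all2 (denotes s) xs' is'"
      using PrimRec.prems by (auto simp: list_all2_Cons1)
    have lt: "x < k" "\<forall>x\<in>set xs'. x < k" using PrimRec.prems Cons by auto
    have s: "s 0 = v" "s (Suc 0) = w" "s 2 = q" using PrimRec.prems by (auto simp: at_roots_def)
    let ?s2 = "\<lambda>r a b. s(k := r, k + 1 := num a, k + 2 := num b)"
    let ?s4 = "\<lambda>r a b a' b'. (?s2 r a b)(k + 3 := num a', k + 4 := num b')"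
    have cong: "list_all2 (denotes t) xs' is'" if "\<And>x. x < k \<Longrightarrow> t x = s x" for t
      using list_all2_denotes_cong[of xs' t s is'] that lt is' by auto
    have f: "sat V E (?s2 r a b) (val_fm f xs' (k + 2) (k + 3)) \<longleftrightarrow> bounded_eval N relations f is' b"
      if "b < N" for r a b
    proof (rule PrimRec.IH(1))
      show "at_roots (?s2 r a b)" using PrimRec.prems by simp
      show "denotes (?s2 r a b) (k + 2) b" using that by simp
      show "list_all2 (denotes (?s2 r a b)) xs' is'" by (rule cong) simp
    qed (use PrimRec.prems lt in auto)
    have g: "sat V E (?s4 r a b a' b') (val_fm g ((k + 3) # (k + 4) # xs') (k + 2) (k + 5)) \<longleftrightarrow>
        bounded_eval N relations g (a' # b' # is') b"
      if "b < N" "a' < N" "b' < N" for r a b a' b'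
    proof (rule PrimRec.IH(2))
      show "at_roots (?s4 r a b a' b')" using PrimRec.prems by simp
      show "denotes (?s4 r a b a' b') (k + 2) b" using that by simp
      have "list_all2 (denotes (?s4 r a b a' b')) xs' is'" by (rule cong) simp
      then show "list_all2 (denotes (?s4 r a b a' b')) ((k + 3) # (k + 4) # xs') (a' # b' # is')"
        using that by simp
    qed (use PrimRec.prems lt in auto)
    have zero: "sat V E (?s2 r a b) (zero_fm (k + 1)) \<longleftrightarrow> a = 0" if "a < N" for r a b
      using PrimRec.prems that by (intro sat_zero_fm) auto
    have succ: "sat V E (?s4 r a b a' b') (succ_fm (k + 3) (k + 1)) \<longleftrightarrow> a = Suc a'"
      if "a < N" "a' < N" for r a b a' b'
      using PrimRec.prems that by (intro sat_succ_fm) auto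
    have "sat V E s (val_fm (PrimRec f g) xs y k) \<longleftrightarrow>
      (\<exists>r\<in>V. coded_pair V E q r (num i) (num j) \<and>
        (\<forall>a<N. \<forall>b<N. coded_pair V E q r (num a) (num b) \<longrightarrow>
          sat V E (?s2 r a b) (zero_fm (k + 1)) \<and> sat V E (?s2 r a b) (val_fm f xs' (k + 2) (k + 3)) \<or>
          (\<exists>a'<N. \<exists>b'<N. sat V E (?s4 r a b a' b') (succ_fm (k + 3) (k + 1)) \<and>
            coded_pair V E q r (num a') (num b') \<and>
            sat V E (?s4 r a b a' b') (val_fm g ((k + 3) # (k + 4) # xs') (k + 2) (k + 5)))))"
      using PrimRec.prems i lt Cons s
      by (simp add: sat_num_all sat_num_ex denotes_def)
    also have "\<dots> \<longleftrightarrow> (\<exists>r\<in>V. coded_pair V E q r (num i) (num j) \<and>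
        (\<forall>a<N. \<forall>b<N. coded_pair V E q r (num a) (num b) \<longrightarrow>
          a = 0 \<and> bounded_eval N relations f is' b \<or>
          (\<exists>a'<N. \<exists>b'<N. a = Suc a' \<and> coded_pair V E q r (num a') (num b') \<and>
            bounded_eval N relations g (a' # b' # is') b)))"
      by (simp only: f g zero succ cong: conj_cong imp_cong)
    also have "\<dots> \<longleftrightarrow> bounded_eval N relations (PrimRec f g) is j"
      using i PrimRec.prems(6) unfolding "is" relations_def by (simp add: denotes_def cong: conj_cong)
    finally show ?thesis .
  qed
next
  case (Mu f)
  have s: "s 0 = v" using Mu.prems by (auto simp: at_roots_def)
  let ?s1 = "\<lambda>m. s(k := num m)"
  let ?s3 = "\<lambda>m l t. s(k := num m, k + 1 := num l, k + 2 := num t)"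
  have cong: "list_all2 (denotes t) xs is" if "\<And>x. x < k \<Longrightarrow> t x = s x" for t
    using list_all2_denotes_cong[of xs t s "is"] that Mu.prems by auto
  have f0: "sat V E (?s1 l) (val_fm f (y # xs) k (k + 1)) \<longleftrightarrow> bounded_eval N relations f (j # is) l"
    if "l < N" for l
  proof (rule Mu.IH)
    show "at_roots (?s1 l)" using Mu.prems by simp
    show "denotes (?s1 l) k l" using that by simp
    have "list_all2 (denotes (?s1 l)) xs is" by (rule cong) simp
    then show "list_all2 (denotes (?s1 l)) (y # xs) (j # is)" using Mu.prems by simp
  qed (use Mu.prems in auto)
  have f: "sat V E (?s3 m l t) (val_fm f (k # xs) (k + 1) (k + 3)) \<longleftrightarrow>
      bounded_eval N relations f (m # is) l" if "m < N" "l < N" for m l t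
  proof (rule Mu.IH)
    show "at_roots (?s3 m l t)" using Mu.prems by simp
    show "denotes (?s3 m l t) (k + 1) l" using that by simp
    have "list_all2 (denotes (?s3 m l t)) xs is" by (rule cong) simp
    then show "list_all2 (denotes (?s3 m l t)) (k # xs) (m # is)" using that by simp
  qed (use Mu.prems in auto)
  have zero: "sat V E (?s1 m) (zero_fm k) \<longleftrightarrow> m = 0" if "m < N" for m
    using Mu.prems that by (intro sat_zero_fm) auto
  have succ: "sat V E (?s3 m l t) (succ_fm (k + 2) (k + 1)) \<longleftrightarrow> l = Suc t"
    if "l < N" "t < N" for m l t
    using Mu.prems that by (intro sat_succ_fm) auto
  have le: "sat V E (?s1 m) (le_fm y k) \<longleftrightarrow> j \<le> m" if "m < N" for m
    using Mu.prems that by (intro sat_le_fm_num) auto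
  have "sat V E s (val_fm (Mu f) xs y k) \<longleftrightarrow>
      (\<exists>l<N. sat V E (?s1 l) (zero_fm k) \<and> sat V E (?s1 l) (val_fm f (y # xs) k (k + 1))) \<and>
      (\<forall>m<N. sat V E (?s1 m) (le_fm y k) \<or> (\<exists>l<N. \<exists>t<N.
        sat V E (?s3 m l t) (succ_fm (k + 2) (k + 1)) \<and>
        sat V E (?s3 m l t) (val_fm f (k # xs) (k + 1) (k + 3))))"
    using Mu.prems s by (simp add: sat_num_all sat_num_ex del: sat_le_fm)
  also have "\<dots> \<longleftrightarrow> (\<exists>l<N. l = 0 \<and> bounded_eval N relations f (j # is) l) \<and>
      (\<forall>m<N. j \<le> m \<or> (\<exists>l<N. \<exists>t<N. l = Suc t \<and> bounded_eval N relations f (m # is) l))"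
    by (simp only: f0 f zero succ le cong: conj_cong imp_cong)
  also have "\<dots> \<longleftrightarrow> bounded_eval N relations (Mu f) is j"
  proof -
    have "j < N" using Mu.prems by (simp add: denotes_def)
    then have "(\<forall>m<N. j \<le> m \<or> Q m) \<longleftrightarrow> (\<forall>m<j. Q m)" for Q
      by (meson less_trans not_le)
    moreover have "(\<exists>l<N. \<exists>t<N. l = Suc t \<and> Q l) \<longleftrightarrow> (\<exists>t. Suc t < N \<and> Q (Suc t))" for Q
      using Suc_lessD by blast
    moreover have "(\<exists>l<N. l = 0 \<and> Q l) \<longleftrightarrow> 0 < N \<and> Q 0" for Q
      by auto
    ultimately show ?thesis
      by (simp only: bounded_eval.simps conj_assoc)
  qed
  finally show ?case .
qed

end

section \<open>Sentences about a numeral\<close>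

definition linear_fm :: fm where
  "linear_fm = num_all 3 (num_all 4 (Conj (disj_fm (le_fm 3 4) (le_fm 4 3))
     (disj_fm (Eq 3 4) (Neg (Conj (le_fm 3 4) (le_fm 4 3))))))"

lemma sat_linear_fm:
  "sat V E s linear_fm \<longleftrightarrow>
    (\<forall>x\<in>{x\<in>V. E (s 0) x}. \<forall>y\<in>{x\<in>V. E (s 0) x}.
      (le_via V E (s 1) x y \<or> le_via V E (s 1) y x) \<and>
      (le_via V E (s 1) x y \<longrightarrow> le_via V E (s 1) y x \<longrightarrow> x = y))"
  by (auto simp: linear_fm_def num_all_def num_ex_def)

lemma (in number_graph) sat_linear:
  assumes "at_roots s"
  shows "sat V E s linear_fm"
proof -
  have D: "{x\<in>V. E v x} = num ` {..<N}"
    using bij_num by (simp add: bij_betw_def)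
  show ?thesis
    using assms unfolding sat_linear_fm at_roots_def by (auto simp: D le_via_num)
qed

text \<open>Under the linearity condition a number is determined by how many neighbours of \<open>w\<close> it
sees, and the order of the numbers is the order of these counts. Listing the finitely many
counts in increasing order therefore enumerates the numbers.\<close>

lemma number_graph_if_linear:
  assumes fin: "finite V" and lin: "sat V E s linear_fm"
  obtains N num where "number_graph V E (s 0) (s 1) N num"
proof -
  let ?D = "{x\<in>V. E (s 0) x}"
  define \<kappa> where "\<kappa> x = card {u\<in>V. E (s 1) u \<and> E x u}" for x
  have mono: "le_via V E (s 1) x y \<longleftrightarrow> \<kappa> x \<le> \<kappa> y" if xy: "x \<in> ?D" "y \<in> ?D" for x y
  proof
    assume "le_via V E (s 1) x y"
    then show "\<kappa> x \<le> \<kappa> y"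
      unfolding \<kappa>_def le_via_def using fin by (intro card_mono) auto
  next
    assume le: "\<kappa> x \<le> \<kappa> y"
    show "le_via V E (s 1) x y"
    proof (rule ccontr)
      assume not_le: "\<not> le_via V E (s 1) x y"
      with lin xy have "le_via V E (s 1) y x"
        unfolding sat_linear_fm by blast
      with not_le have "{u\<in>V. E (s 1) u \<and> E y u} \<subset> {u\<in>V. E (s 1) u \<and> E x u}"
        by (auto simp: le_via_def)
      then have "\<kappa> y < \<kappa> x"
        unfolding \<kappa>_def using fin by (intro psubset_card_mono) auto
      with le show False by simp
    qed
  qed
  have inj: "inj_on \<kappa> ?D"
  proof (rule inj_onI)
    fix x y assume xy: "x \<in> ?D" "y \<in> ?D" and "\<kappa> x = \<kappa> y"
    then have "le_via V E (s 1) x y" "le_via V E (s 1) y x"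
      using mono by auto
    with lin xy show "x = y"
      unfolding sat_linear_fm by blast
  qed
  obtain h where h: "bij_betw h {..<card (\<kappa> ` ?D)} (\<kappa> ` ?D)" "strict_mono_on {..<card (\<kappa> ` ?D)} h"
    using ex_bij_betw_strict_mono_card[of "\<kappa> ` ?D"] fin by auto
  let ?N = "card (\<kappa> ` ?D)"
  let ?num = "\<lambda>i. the_inv_into ?D \<kappa> (h i)"
  have "bij_betw (the_inv_into ?D \<kappa>) (\<kappa> ` ?D) ?D"
    using inj by (simp add: bij_betw_the_inv_into inj_on_imp_bij_betw)
  from bij_betw_trans[OF h(1) this] have bij: "bij_betw ?num {..<?N} ?D"
    by (simp add: comp_def)
  have \<kappa>: "\<kappa> (?num i) = h i" if "i < ?N" for i
    using h(1) that by (intro f_the_inv_into_f inj) (auto simp: bij_betw_def)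
  have "number_graph V E (s 0) (s 1) ?N ?num"
  proof
    show "bij_betw ?num {..<?N} ?D" by (rule bij)
    show "le_via V E (s 1) (?num i) (?num j) \<longleftrightarrow> i \<le> j" if ij: "i < ?N" "j < ?N" for i j
    proof -
      have "?num i \<in> ?D" "?num j \<in> ?D"
        using bij ij by (auto dest: bij_betwE)
      then show ?thesis
        using mono \<kappa> ij strict_mono_on_less_eq[OF h(2)] by auto
    qed
  qed
  then show thesis by (rule that)
qed

text \<open>Variable \<open>3\<close> is the free variable of the formulas under consideration. The formula
\<open>shift_fm \<phi>\<close> says \<open>\<phi>\<close> of the successor of its value. It rebinds variable \<open>3\<close> by way of variable
\<open>4\<close>, so that the iterates use no new variables and the code of an iterate is obtained from that
of \<open>\<phi>\<close> by a fixed number of pairings per step.\<close>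

definition shift_fm :: "fm \<Rightarrow> fm" where
  "shift_fm \<phi> = num_ex 4 (Conj (succ_fm 3 4) (Ex 3 (Conj (Eq 3 4) \<phi>)))"

definition at_zero_fm :: "fm \<Rightarrow> fm" where
  "at_zero_fm \<phi> = Ex 0 (Ex 1 (Ex 2 (Conj linear_fm (num_ex 3 (Conj (zero_fm 3) \<phi>)))))"

text \<open>The sentence \<open>\<phi>(m)\<close>, relative to existentially quantified roots: shifting \<open>m\<close> times and
then starting at \<open>0\<close> evaluates \<open>\<phi>\<close> at \<open>m\<close>, provided that the graph has more than \<open>m\<close> numbers.\<close>

definition instance_fm :: "fm \<Rightarrow> nat \<Rightarrow> fm" where
  "instance_fm \<phi> m = at_zero_fm ((shift_fm ^^ m) \<phi>)"

definition vanishes_fm :: "recf \<Rightarrow> fm" where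
  "vanishes_fm F = num_ex 4 (Conj (zero_fm 4) (val_fm F [3] 4 5))"

lemma free_vars_shift_fm:
  "free_vars \<phi> \<subseteq> {0, 1, 2, 3} \<Longrightarrow> free_vars ((shift_fm ^^ m) \<phi>) \<subseteq> {0, 1, 2, 3}"
  by (induction m) (auto simp: shift_fm_def)

lemma free_vars_vanishes_fm: "free_vars (vanishes_fm F) \<subseteq> {0, 1, 2, 3}"
  using free_vars_val_fm[of F "[3]" 4 5] by (auto simp: vanishes_fm_def)

lemma sentence_instance_fm:
  assumes "free_vars \<phi> \<subseteq> {0, 1, 2, 3}"
  shows "sentence (instance_fm \<phi> m)"
  using free_vars_shift_fm[OF assms, of m]
  by (auto simp: sentence_def instance_fm_def at_zero_fm_def linear_fm_def)

context number_graph begin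

lemma num_in_V: "i < N \<Longrightarrow> num i \<in> V"
  using bij_num by (auto dest: bij_betwE)

lemma sat_shift_fm:
  assumes "at_roots s" "denotes s 3 i" "free_vars \<phi> \<subseteq> {0, 1, 2, 3}"
  shows "sat V E s (shift_fm \<phi>) \<longleftrightarrow> Suc i < N \<and> sat V E (s(3 := num (Suc i))) \<phi>"
proof -
  have succ: "sat V E (s(4 := num j)) (succ_fm 3 4) \<longleftrightarrow> j = Suc i" if "j < N" for j
    using assms that by (intro sat_succ_fm) auto
  \<comment> \<open>Variable \<open>4\<close> only carries the successor over to variable \<open>3\<close>.\<close>
  have \<phi>: "sat V E (s(4 := num j, 3 := num j)) \<phi> \<longleftrightarrow> sat V E (s(3 := num j)) \<phi>" for j
    using assms(3) by (intro sat_cong) auto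
  have "sat V E s (shift_fm \<phi>) \<longleftrightarrow>
      (\<exists>j<N. sat V E (s(4 := num j)) (succ_fm 3 4) \<and>
        (\<exists>a\<in>V. a = num j \<and> sat V E (s(4 := num j, 3 := a)) \<phi>))"
    using assms(1) by (simp add: shift_fm_def sat_num_ex at_roots_def)
  also have "\<dots> \<longleftrightarrow> (\<exists>j<N. j = Suc i \<and> sat V E (s(3 := num j)) \<phi>)"
    using succ \<phi> num_in_V by blast
  finally show ?thesis by blast
qed

lemma sat_shift_fm_power:
  assumes "at_roots s" "denotes s 3 i" "free_vars \<phi> \<subseteq> {0, 1, 2, 3}"
  shows "sat V E s ((shift_fm ^^ m) \<phi>) \<longleftrightarrow> i + m < N \<and> sat V E (s(3 := num (i + m))) \<phi>"
  using assms(1,2)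
proof (induction m arbitrary: s i)
  case 0
  then have "s(3 := num i) = s"
    by (auto simp: denotes_def)
  with 0 show ?case by (simp add: denotes_def)
next
  case (Suc m)
  have "sat V E s ((shift_fm ^^ Suc m) \<phi>) \<longleftrightarrow>
      Suc i < N \<and> sat V E (s(3 := num (Suc i))) ((shift_fm ^^ m) \<phi>)"
    using sat_shift_fm[OF Suc.prems free_vars_shift_fm[OF assms(3)]] by simp
  also have "\<dots> \<longleftrightarrow> Suc i < N \<and> Suc i + m < N \<and> sat V E (s(3 := num (Suc i), 3 := num (Suc i + m))) \<phi>"
  proof (rule conj_cong[OF refl], rule Suc.IH)
    show "at_roots (s(3 := num (Suc i)))" using Suc.prems by simp
    show "denotes (s(3 := num (Suc i))) 3 (Suc i)" if "Suc i < N" using that by simp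
  qed
  also have "\<dots> \<longleftrightarrow> i + Suc m < N \<and> sat V E (s(3 := num (i + Suc m))) \<phi>"
    by auto
  finally show ?case .
qed

lemma sat_vanishes_fm:
  assumes "at_roots s" "denotes s 3 m"
  shows "sat V E s (vanishes_fm F) \<longleftrightarrow> bounded_eval N relations F [m] 0"
proof -
  have "sat V E (s(4 := num j)) (zero_fm 4) \<longleftrightarrow> j = 0" if "j < N" for j
    using assms that by (intro sat_zero_fm) auto
  moreover have "sat V E (s(4 := num j)) (val_fm F [3] 4 5) \<longleftrightarrow> bounded_eval N relations F [m] j"
    if "j < N" for j
    using assms that by (intro sat_val_fm) auto
  moreover have "sat V E s (vanishes_fm F) \<longleftrightarrow> (\<exists>j<N. sat V E (s(4 := num j)) (zero_fm 4) \<and>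
      sat V E (s(4 := num j)) (val_fm F [3] 4 5))"
    using assms(1) by (simp add: vanishes_fm_def sat_num_ex at_roots_def)
  moreover have "0 < N" using assms(2) by (simp add: denotes_def)
  ultimately show ?thesis by blast
qed

lemma sat_instance_fm:
  assumes "at_roots s"
  shows "sat V E s (num_ex 3 (Conj (zero_fm 3) ((shift_fm ^^ m) (vanishes_fm F)))) \<longleftrightarrow>
    m < N \<and> bounded_eval N relations F [m] 0"
proof -
  have zero: "sat V E (s(3 := num i)) (zero_fm 3) \<longleftrightarrow> i = 0" if "i < N" for i
    using assms that by (intro sat_zero_fm) auto
  have "sat V E s (num_ex 3 (Conj (zero_fm 3) ((shift_fm ^^ m) (vanishes_fm F)))) \<longleftrightarrow>
    (\<exists>i<N. sat V E (s(3 := num i)) (zero_fm 3) \<and>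
      sat V E (s(3 := num i)) ((shift_fm ^^ m) (vanishes_fm F)))"
    using assms by (simp add: sat_num_ex at_roots_def)
  also have "\<dots> \<longleftrightarrow> 0 < N \<and> sat V E (s(3 := num 0)) ((shift_fm ^^ m) (vanishes_fm F))"
    using zero by blast
  also have "\<dots> \<longleftrightarrow> m < N \<and> sat V E (s(3 := num m)) (vanishes_fm F)"
    using sat_shift_fm_power[OF _ _ free_vars_vanishes_fm, of "s(3 := num 0)" 0 m] assms by auto
  also have "\<dots> \<longleftrightarrow> m < N \<and> bounded_eval N relations F [m] 0"
    using sat_vanishes_fm[of "s(3 := num m)" m] assms by auto
  finally show ?thesis .
qed

end

text \<open>The roots that witness the sentence may lie anywhere in the graph and may look nothing
like those intended; linearity together with the soundness of bounded evaluation suffices.\<close>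

lemma rec_eval_if_models_instance_fm:
  assumes "finite V" "V \<noteq> {}" and "models V E (instance_fm (vanishes_fm F) m)"
  shows "rec_eval F [m] 0"
proof -
  from \<open>V \<noteq> {}\<close> obtain z where "z \<in> V" by blast
  with assms(3) have "sat V E (\<lambda>_. z) (instance_fm (vanishes_fm F) m)"
    by (simp add: models_def)
  then obtain s where lin: "sat V E s linear_fm"
    and s: "sat V E s (num_ex 3 (Conj (zero_fm 3) ((shift_fm ^^ m) (vanishes_fm F))))"
    by (auto simp: instance_fm_def at_zero_fm_def)
  obtain N num where "number_graph V E (s 0) (s 1) N num"
    using number_graph_if_linear[OF assms(1) lin] .
  then interpret number_graph V E "s 0" "s 1" "s 2" N num .
  have "at_roots s" unfolding at_roots_def by simp
  with s have "m < N" "bounded_eval N relations F [m] 0"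
    by (simp_all only: sat_instance_fm)
  then show ?thesis
    by (auto intro: bounded_eval_sound)
qed

section \<open>A finite graph that codes all relations\<close>

text \<open>The copy has no edges to the remaining vertices, so that quantifiers over neighbours of
its vertices cannot leave it.\<close>

definition isolated_copy ::
  "'b set \<Rightarrow> ('b \<Rightarrow> 'b \<Rightarrow> bool) \<Rightarrow> ('b \<Rightarrow> 'a) \<Rightarrow> 'a set \<Rightarrow> ('a \<Rightarrow> 'a \<Rightarrow> bool) \<Rightarrow> bool" where
  "isolated_copy C K e V E \<longleftrightarrow> inj_on e C \<and> e ` C \<subseteq> V \<and>
     (\<forall>x\<in>C. \<forall>z\<in>V. E (e x) z \<longleftrightarrow> (\<exists>y\<in>C. z = e y \<and> K x y))"

text \<open>The number \<open>i\<close> sees exactly the levels up to \<open>i\<close>, which makes inclusion of neighbourhoods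
among the levels the usual order. For every relation \<open>R\<close> there is a vertex coding it, and for
every pair in \<open>R\<close> there are two vertices \<open>First\<close> and \<open>Second\<close> that belong to this pair and this
relation only, so that the codes of different relations do not interfere.\<close>

datatype gadget =
    NumberRoot
  | LevelRoot
  | PairRoot
  | Number nat
  | Level nat
  | Relation "(nat \<times> nat) set"
  | First "(nat \<times> nat) set" nat nat
  | Second "(nat \<times> nat) set" nat nat

fun arc :: "gadget \<Rightarrow> gadget \<Rightarrow> bool" where
  "arc NumberRoot (Number i) = True"
| "arc LevelRoot (Level l) = True"
| "arc PairRoot (First R i j) = True"
| "arc (Number i) (Level l) = (l \<le> i)"
| "arc (Relation R) (First R' i j) = (R = R')"
| "arc (First R i j) (Number i') = (i = i')"
| "arc (First R i j) (Second R' i' j') = (R = R' \<and> i = i' \<and> j = j')"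
| "arc (Second R i j) (Number j') = (j = j')"
| "arc _ _ = False"

definition gadget_adj :: "gadget \<Rightarrow> gadget \<Rightarrow> bool" where
  "gadget_adj x y \<longleftrightarrow> arc x y \<or> arc y x"

definition gadgets :: "nat \<Rightarrow> gadget set" where
  "gadgets N = {NumberRoot, LevelRoot, PairRoot} \<union> Number ` {..<N} \<union> Level ` {..<N} \<union>
     Relation ` Pow ({..<N} \<times> {..<N}) \<union>
     (\<lambda>(R, i, j). First R i j) ` (SIGMA R:Pow ({..<N} \<times> {..<N}). R) \<union>
     (\<lambda>(R, i, j). Second R i j) ` (SIGMA R:Pow ({..<N} \<times> {..<N}). R)"

lemma finite_gadgets: "finite (gadgets N)"
proof -
  have "finite (SIGMA R:Pow ({..<N} \<times> {..<N}). R)"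
    by (intro finite_SigmaI) (auto intro: finite_subset[of _ "{..<N} \<times> {..<N}"])
  then show ?thesis
    unfolding gadgets_def by simp
qed

lemma gadget_adj_sym: "gadget_adj x y \<longleftrightarrow> gadget_adj y x"
  by (auto simp: gadget_adj_def)

lemma gadget_adj_irrefl: "\<not> gadget_adj x x"
  by (cases x) (auto simp: gadget_adj_def)

lemma mem_gadgets [simp]:
  "NumberRoot \<in> gadgets N" "LevelRoot \<in> gadgets N" "PairRoot \<in> gadgets N"
  "Number i \<in> gadgets N \<longleftrightarrow> i < N" "Level i \<in> gadgets N \<longleftrightarrow> i < N"
  "Relation R \<in> gadgets N \<longleftrightarrow> R \<subseteq> {..<N} \<times> {..<N}"
  "First R i j \<in> gadgets N \<longleftrightarrow> R \<subseteq> {..<N} \<times> {..<N} \<and> (i, j) \<in> R"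
  "Second R i j \<in> gadgets N \<longleftrightarrow> R \<subseteq> {..<N} \<times> {..<N} \<and> (i, j) \<in> R"
  by (auto simp: gadgets_def image_iff Bex_def)

lemma gadget_adj_simps [simp]:
  "gadget_adj NumberRoot y \<longleftrightarrow> (\<exists>i. y = Number i)"
  "gadget_adj LevelRoot y \<longleftrightarrow> (\<exists>l. y = Level l)"
  "gadget_adj PairRoot y \<longleftrightarrow> (\<exists>R i j. y = First R i j)"
  "gadget_adj (Number i) (Level l) \<longleftrightarrow> l \<le> i"
  "\<not> gadget_adj (Number i) (Number j)"
  "gadget_adj (Relation R) y \<longleftrightarrow> (\<exists>i j. y = First R i j)"
  "gadget_adj (First R i j) y \<longleftrightarrow> y \<in> {PairRoot, Relation R, Number i, Second R i j}"
  "gadget_adj (Second R i j) y \<longleftrightarrow> y \<in> {First R i j, Number j}"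
  by (simp_all add: gadget_adj_def) (cases y; auto)+

text \<open>Both the order and the coded relations are defined by formulas that only walk along edges
from the roots. In an isolated copy such walks stay inside, hence can be computed in the gadget
graph.\<close>

lemma isolated_copy_gadgets:
  assumes copy: "isolated_copy (gadgets N) gadget_adj e V E"
  shows "number_graph V E (e NumberRoot) (e LevelRoot) N (e \<circ> Number)"
    and "number_graph.relations V E (e PairRoot) N (e \<circ> Number) = Pow ({..<N} \<times> {..<N})"
proof -
  let ?C = "gadgets N"
  have inj: "e x = e y \<longleftrightarrow> x = y" if "x \<in> ?C" "y \<in> ?C" for x y
    using copy that by (auto simp: isolated_copy_def inj_on_def)
  have in_V: "e x \<in> V" if "x \<in> ?C" for x
    using copy that by (auto simp: isolated_copy_def)
  have nbr: "E (e x) z \<longleftrightarrow> (\<exists>y\<in>?C. z = e y \<and> gadget_adj x y)" if "x \<in> ?C" "z \<in> V" for x z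
    using copy that unfolding isolated_copy_def by simp
  have adj: "E (e x) (e y) \<longleftrightarrow> gadget_adj x y" if "x \<in> ?C" "y \<in> ?C" for x y
    using that by (auto simp: nbr in_V inj)
  have ex: "(\<exists>z\<in>V. E (e x) z \<and> P z) \<longleftrightarrow> (\<exists>y\<in>?C. gadget_adj x y \<and> P (e y))" if "x \<in> ?C" for x P
    using that by (auto simp: nbr intro: in_V)
  show graph: "number_graph V E (e NumberRoot) (e LevelRoot) N (e \<circ> Number)"
  proof
    have "{x\<in>V. E (e NumberRoot) x} = (e \<circ> Number) ` {..<N}"
      using ex[of NumberRoot "\<lambda>z. z = x" for x] by auto
    moreover have "inj_on (e \<circ> Number) {..<N}"
      by (rule inj_onI) (simp add: inj)
    ultimately show "bij_betw (e \<circ> Number) {..<N} {x\<in>V. E (e NumberRoot) x}"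
      by (simp add: bij_betw_def)
    show "le_via V E (e LevelRoot) ((e \<circ> Number) i) ((e \<circ> Number) j) \<longleftrightarrow> i \<le> j"
      if ij: "i < N" "j < N" for i j
    proof -
      have "le_via V E (e LevelRoot) (e (Number i)) (e (Number j)) \<longleftrightarrow>
          \<not> (\<exists>z\<in>V. E (e LevelRoot) z \<and> E (e (Number i)) z \<and> \<not> E (e (Number j)) z)"
        by (auto simp: le_via_def)
      also have "\<dots> \<longleftrightarrow> \<not> (\<exists>l<N. l \<le> i \<and> \<not> l \<le> j)"
      proof -
        have "(\<exists>y\<in>?C. gadget_adj LevelRoot y \<and> P y) \<longleftrightarrow> (\<exists>l<N. P (Level l))" for P
          by auto
        then show ?thesis
          unfolding ex[OF mem_gadgets(2)] using ij by (simp add: adj cong: conj_cong)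
      qed
      also have "\<dots> \<longleftrightarrow> i \<le> j"
        using ij by auto
      finally show ?thesis by simp
    qed
  qed
  interpret number_graph V E "e NumberRoot" "e LevelRoot" "e PairRoot" N "e \<circ> Number"
    by (rule graph)
  have coded: "{(i, j). i < N \<and> j < N \<and> coded_pair V E (e PairRoot) (e (Relation R))
      ((e \<circ> Number) i) ((e \<circ> Number) j)} = R" if R: "R \<subseteq> {..<N} \<times> {..<N}" for R
  proof -
    have "coded_pair V E (e PairRoot) (e (Relation R)) (e (Number i)) (e (Number j)) \<longleftrightarrow> (i, j) \<in> R"
      if ij: "i < N" "j < N" for i j
    proof -
      have "coded_pair V E (e PairRoot) (e (Relation R)) (e (Number i)) (e (Number j)) \<longleftrightarrow>
          (\<exists>c\<in>V. E (e PairRoot) c \<and> E (e (Relation R)) c \<and> E c (e (Number i)) \<and>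
            (\<exists>d\<in>V. E c d \<and> E d (e (Number j))))"
        unfolding coded_pair_def by blast
      also have "\<dots> \<longleftrightarrow> (\<exists>c\<in>?C. gadget_adj PairRoot c \<and> gadget_adj (Relation R) c \<and>
          gadget_adj c (Number i) \<and> (\<exists>d\<in>?C. gadget_adj c d \<and> gadget_adj d (Number j)))"
        unfolding ex[OF mem_gadgets(3)] using ij R by (auto simp: adj ex)
      also have "\<dots> \<longleftrightarrow> (i, j) \<in> R"
      proof -
        have c: "(\<exists>c\<in>?C. gadget_adj PairRoot c \<and> gadget_adj (Relation R) c \<and> Q c) \<longleftrightarrow>
            (\<exists>i' j'. (i', j') \<in> R \<and> Q (First R i' j'))" (is "?l \<longleftrightarrow> ?r") for Q
        proof
          assume ?l
          then obtain i' j' where "First R i' j' \<in> ?C" "Q (First R i' j')"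
            by auto
          then show ?r
            by (intro exI[of _ i'] exI[of _ j']) simp
        next
          assume ?r
          then obtain i' j' where "(i', j') \<in> R" "Q (First R i' j')"
            by blast
          with R show ?l
            by (intro bexI[of _ "First R i' j'"]) simp_all
        qed
        have d: "(\<exists>d\<in>?C. gadget_adj (First R i' j') d \<and> gadget_adj d (Number j)) \<longleftrightarrow> j' = j"
          if "(i', j') \<in> R" for i' j'
          using that R by (auto intro!: bexI[of _ "Second R i' j'"])
        show ?thesis
          unfolding c by (simp only: d cong: conj_cong) auto
      qed
      finally show ?thesis .
    qed
    with R show ?thesis by auto
  qed
  show "relations = Pow ({..<N} \<times> {..<N})"
  proof
    show "relations \<subseteq> Pow ({..<N} \<times> {..<N})"
      by (auto simp: relations_def)
    show "Pow ({..<N} \<times> {..<N}) \<subseteq> relations"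
    proof
      fix R assume "R \<in> Pow ({..<N} \<times> {..<N})"
      then have R: "R \<subseteq> {..<N} \<times> {..<N}" by simp
      then show "R \<in> relations"
        unfolding relations_def using coded[OF R] in_V[of "Relation R"] by (intro image_eqI) auto
    qed
  qed
qed

lemma models_instance_fm_if_rec_eval:
  assumes "rec_eval F [m] 0"
  obtains N where "\<And>e V E. isolated_copy (gadgets N) gadget_adj e V E \<Longrightarrow>
    models V E (instance_fm (vanishes_fm F) m)"
proof -
  have "\<forall>\<^sub>F N in sequentially. m < N \<and> bounded_eval N (Pow ({..<N} \<times> {..<N})) F [m] 0"
    using bounded_eval_complete[OF assms] by (intro eventually_conj eventually_gt_at_top)
  then obtain N where N: "m < N" "bounded_eval N (Pow ({..<N} \<times> {..<N})) F [m] 0"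
    by (auto simp: eventually_sequentially)
  show thesis
  proof (rule that)
    fix e :: "gadget \<Rightarrow> 'a" and V E
    assume copy: "isolated_copy (gadgets N) gadget_adj e V E"
    interpret number_graph V E "e NumberRoot" "e LevelRoot" "e PairRoot" N "e \<circ> Number"
      by (rule isolated_copy_gadgets(1)[OF copy])
    have roots: "e NumberRoot \<in> V" "e LevelRoot \<in> V" "e PairRoot \<in> V"
      using copy by (auto simp: isolated_copy_def)
    show "models V E (instance_fm (vanishes_fm F) m)"
      unfolding models_def
    proof (intro allI impI)
      fix s :: "nat \<Rightarrow> 'a"
      let ?s = "s(0 := e NumberRoot, 1 := e LevelRoot, 2 := e PairRoot)"
      have at_roots: "at_roots ?s"
        by (simp add: at_roots_def)
      have "sat V E ?s (num_ex 3 (Conj (zero_fm 3) ((shift_fm ^^ m) (vanishes_fm F))))"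
        unfolding sat_instance_fm[OF at_roots] isolated_copy_gadgets(2)[OF copy] using N by simp
      with sat_linear[OF at_roots] roots show "sat V E s (instance_fm (vanishes_fm F) m)"
        unfolding instance_fm_def at_zero_fm_def by (simp del: One_nat_def) blast
    qed
  qed
qed

section \<open>Independent cylinder events with small overlaps\<close>

lemma prob_Pi_pmf_cylinder:
  assumes "finite I" "T \<subseteq> I"
  shows "measure_pmf.prob (Pi_pmf I d P) {\<omega>. \<forall>e\<in>T. \<omega> e = t e} = (\<Prod>e\<in>T. pmf (P e) (t e))"
proof -
  have "{\<omega>. \<forall>e\<in>T. \<omega> e = t e} = Pi I (\<lambda>e. if e \<in> T then {t e} else UNIV)"
    using assms(2) by (auto simp: Pi_def)
  then have "measure_pmf.prob (Pi_pmf I d P) {\<omega>. \<forall>e\<in>T. \<omega> e = t e} =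
      (\<Prod>e\<in>I. measure_pmf.prob (P e) (if e \<in> T then {t e} else UNIV))"
    using assms(1) by (simp add: measure_Pi_pmf_Pi)
  also have "\<dots> = (\<Prod>e\<in>T. measure_pmf.prob (P e) (if e \<in> T then {t e} else UNIV))"
    using assms by (intro prod.mono_neutral_right) auto
  also have "\<dots> = (\<Prod>e\<in>T. pmf (P e) (t e))"
    by (intro prod.cong) (auto simp: measure_pmf_single)
  finally show ?thesis .
qed

text \<open>The second moment method with an exceptional set: for a fixed \<open>i\<close> at most \<open>b\<close> events may
be correlated with \<open>A i\<close> by more than the factor \<open>\<kappa>\<close>. For the number \<open>X\<close> of events that occur,
with mean \<open>m\<close>, this gives \<open>E X\<^sup>2 \<le> \<kappa> m\<^sup>2 + b m\<close>, where the second term comes from the trivial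
bound on exceptional pairs. If no event occurs then \<open>(X - m)\<^sup>2 = m\<^sup>2\<close>, as in the inequality of
Chebyshev.\<close>

lemma second_moment_bound:
  fixes P :: "'b pmf" and A :: "'i \<Rightarrow> 'b set"
  assumes "finite I" "I \<noteq> {}" and "0 < \<mu>" "\<And>i. i \<in> I \<Longrightarrow> \<mu> \<le> measure_pmf.prob P (A i)"
    and "1 \<le> \<kappa>"
    and b: "\<And>i. i \<in> I \<Longrightarrow> real (card {j\<in>I. measure_pmf.prob P (A i \<inter> A j) >
      \<kappa> * (measure_pmf.prob P (A i) * measure_pmf.prob P (A j))}) \<le> b"
  shows "measure_pmf.prob P (- (\<Union>i\<in>I. A i)) \<le> (\<kappa> - 1) + b / (real (card I) * \<mu>)"
proof -
  let ?pr = "measure_pmf.prob P"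
  define X where "X \<omega> = (\<Sum>i\<in>I. indicator (A i) \<omega> :: real)" for \<omega>
  define m where "m = (\<Sum>i\<in>I. ?pr (A i))"
  define Z where "Z = - (\<Union>i\<in>I. A i)"
  have m_ge: "real (card I) * \<mu> \<le> m"
    unfolding m_def using sum_bounded_below[of I \<mu> "\<lambda>i. ?pr (A i)"] assms(4) by simp
  have card_pos: "0 < real (card I) * \<mu>"
    using assms(1-3) by (simp add: card_gt_0_iff)
  with m_ge have m_pos: "0 < m" by linarith
  have "0 \<le> b"
    using assms(2) b by (meson all_not_in_conv of_nat_0_le_iff order_trans)
  have int: "integrable P (indicator B :: 'b \<Rightarrow> real)" for B
    by (intro integrable_real_indicator) (auto simp: measure_pmf.emeasure_eq_measure)
  have X2: "X \<omega> ^ 2 = (\<Sum>i\<in>I. \<Sum>j\<in>I. indicator (A i \<inter> A j) \<omega>)" for \<omega>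
    by (simp add: X_def power2_eq_square sum_product indicator_inter_arith)
  have intX: "integrable P X" unfolding X_def by (intro Bochner_Integration.integrable_sum int)
  have intX2: "integrable P (\<lambda>\<omega>. X \<omega> ^ 2)" unfolding X2 by (intro Bochner_Integration.integrable_sum int)
  have EX: "measure_pmf.expectation P X = m"
    unfolding X_def m_def by (subst Bochner_Integration.integral_sum) (auto intro: int)
  have EX2: "measure_pmf.expectation P (\<lambda>\<omega>. X \<omega> ^ 2) = (\<Sum>i\<in>I. \<Sum>j\<in>I. ?pr (A i \<inter> A j))"
    unfolding X2 by (subst Bochner_Integration.integral_sum; (intro Bochner_Integration.integrable_sum int)?)+
      (simp add: Bochner_Integration.integral_sum int)
  have row: "(\<Sum>j\<in>I. ?pr (A i \<inter> A j)) \<le> \<kappa> * ?pr (A i) * m + b * ?pr (A i)" if i: "i \<in> I" for i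
  proof -
    let ?bad = "{j\<in>I. ?pr (A i \<inter> A j) > \<kappa> * (?pr (A i) * ?pr (A j))}"
    have "?pr (A i \<inter> A j) \<le> \<kappa> * ?pr (A i) * ?pr (A j) + (if j \<in> ?bad then ?pr (A i) else 0)"
      if "j \<in> I" for j
    proof (cases "j \<in> ?bad")
      case True
      have "?pr (A i \<inter> A j) \<le> ?pr (A i)"
        by (intro measure_pmf.finite_measure_mono) auto
      moreover have "0 \<le> \<kappa> * ?pr (A i) * ?pr (A j)" using assms(5) by simp
      ultimately show ?thesis using True by simp
    qed (use that in \<open>auto simp: not_less mult.assoc\<close>)
    then have "(\<Sum>j\<in>I. ?pr (A i \<inter> A j)) \<le>
        (\<Sum>j\<in>I. \<kappa> * ?pr (A i) * ?pr (A j) + (if j \<in> ?bad then ?pr (A i) else 0))"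
      by (intro sum_mono) auto
    also have "\<dots> = \<kappa> * ?pr (A i) * m + real (card ?bad) * ?pr (A i)"
      using assms(1) by (simp add: sum.distrib m_def sum_distrib_left flip: sum.inter_filter)
    also have "\<dots> \<le> \<kappa> * ?pr (A i) * m + b * ?pr (A i)"
      using b[OF i] by (intro add_left_mono mult_right_mono) auto
    finally show ?thesis .
  qed
  have "measure_pmf.expectation P (\<lambda>\<omega>. X \<omega> ^ 2) \<le> (\<Sum>i\<in>I. \<kappa> * ?pr (A i) * m + b * ?pr (A i))"
    unfolding EX2 by (intro sum_mono row)
  also have "\<dots> = \<kappa> * m ^ 2 + b * m"
    by (simp add: sum.distrib m_def power2_eq_square sum_distrib_left sum_distrib_right mult_ac)
  finally have EX2_le: "measure_pmf.expectation P (\<lambda>\<omega>. X \<omega> ^ 2) \<le> \<kappa> * m ^ 2 + b * m" .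
  have "m ^ 2 * ?pr Z = measure_pmf.expectation P (\<lambda>\<omega>. m ^ 2 * indicator Z \<omega>)"
    by simp
  also have "\<dots> \<le> measure_pmf.expectation P (\<lambda>\<omega>. X \<omega> ^ 2 - 2 * m * X \<omega> + m ^ 2)"
  proof (rule integral_mono)
    show "integrable P (\<lambda>\<omega>. m ^ 2 * indicator Z \<omega>)"
      by (intro integrable_mult_right int)
    show "integrable P (\<lambda>\<omega>. X \<omega> ^ 2 - 2 * m * X \<omega> + m ^ 2)"
      using intX intX2 by simp
    show "m ^ 2 * indicator Z \<omega> \<le> X \<omega> ^ 2 - 2 * m * X \<omega> + m ^ 2" for \<omega>
    proof (cases "\<omega> \<in> Z")
      case True
      then have "X \<omega> = 0" by (auto simp: X_def Z_def indicator_def)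
      with True show ?thesis by simp
    next
      case False
      have "0 \<le> (X \<omega> - m) ^ 2" by simp
      with False show ?thesis by (simp add: power2_diff algebra_simps)
    qed
  qed
  also have "\<dots> = measure_pmf.expectation P (\<lambda>\<omega>. X \<omega> ^ 2) - 2 * m * m + m ^ 2"
    using intX intX2 by (simp add: EX)
  also have "\<dots> \<le> (\<kappa> - 1) * m ^ 2 + b * m"
    using EX2_le by (simp add: power2_eq_square algebra_simps)
  finally have "m ^ 2 * ?pr Z \<le> (\<kappa> - 1) * m ^ 2 + b * m" .
  then have "?pr Z \<le> ((\<kappa> - 1) * m ^ 2 + b * m) / m ^ 2"
    using m_pos by (simp add: pos_le_divide_eq mult.commute)
  also have "\<dots> = (\<kappa> - 1) + b / m"
    using m_pos by (simp add: field_simps power2_eq_square)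
  also have "\<dots> \<le> (\<kappa> - 1) + b / (real (card I) * \<mu>)"
    using m_ge card_pos \<open>0 \<le> b\<close> by (intro add_left_mono divide_left_mono) auto
  finally show ?thesis unfolding Z_def .
qed

text \<open>All events prescribe values of the same configuration \<open>t\<close>, so a cylinder over \<open>T\<close> has
probability \<open>exp (- W(T))\<close> for an additive weight \<open>W\<close>. Two of them are correlated exactly by the
factor \<open>exp (W(T i \<inter> T j))\<close>. No coordinate lies in three of the sets, hence the overlaps of \<open>T
i\<close> with the other sets are disjoint and their weights sum up to at most \<open>W(T i) \<le> S\<close>. So at most
\<open>S / \<delta>\<close> of them exceed \<open>\<delta>\<close>; the additional exceptional index is \<open>i\<close> itself.\<close>

lemma prob_no_cylinder_le:
  fixes P :: "'e \<Rightarrow> 'v pmf" and T :: "'i \<Rightarrow> 'e set"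
  assumes fin: "finite E" and I: "finite I" "I \<noteq> {}" and T: "\<And>i. i \<in> I \<Longrightarrow> T i \<subseteq> E"
    and triple: "\<And>i j l e. e \<in> T i \<Longrightarrow> e \<in> T j \<Longrightarrow> e \<in> T l \<Longrightarrow> i = j \<or> i = l \<or> j = l"
    and pos: "\<And>e. e \<in> E \<Longrightarrow> 0 < pmf (P e) (t e)"
    and S: "\<And>i. i \<in> I \<Longrightarrow> (\<Sum>e\<in>T i. - ln (pmf (P e) (t e))) \<le> S"
    and "0 < \<delta>"
  shows "measure_pmf.prob (Pi_pmf E d P) (- (\<Union>i\<in>I. {\<omega>. \<forall>e\<in>T i. \<omega> e = t e})) \<le>
    (exp \<delta> - 1) + (1 + S / \<delta>) / (real (card I) * exp (- S))"
proof (rule second_moment_bound)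
  let ?pr = "measure_pmf.prob (Pi_pmf E d P)"
  let ?A = "\<lambda>i. {\<omega>. \<forall>e\<in>T i. \<omega> e = t e}"
  define W where "W e = - ln (pmf (P e) (t e))" for e
  have W_nonneg: "0 \<le> W e" if "e \<in> E" for e
    using pos[OF that] by (simp add: W_def pmf_le_1)
  have prob: "?pr {\<omega>. \<forall>e\<in>U. \<omega> e = t e} = exp (- sum W U)" if "U \<subseteq> E" for U
  proof -
    have "?pr {\<omega>. \<forall>e\<in>U. \<omega> e = t e} = (\<Prod>e\<in>U. exp (- W e))"
      unfolding prob_Pi_pmf_cylinder[OF fin that]
      using that pos by (intro prod.cong) (auto simp: W_def)
    also have "\<dots> = exp (- sum W U)"
      using finite_subset[OF that fin] by (simp add: exp_sum sum_negf flip: sum_negf)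
    finally show ?thesis .
  qed
  have finT: "finite (T i)" if "i \<in> I" for i
    using finite_subset[OF T[OF that] fin] .
  have S': "sum W (T i) \<le> S" if "i \<in> I" for i
    using S[OF that] by (simp add: W_def)
  show "exp (- S) \<le> ?pr (?A i)" if "i \<in> I" for i
    using S'[OF that] prob[OF T[OF that]] by simp
  show "real (card {j\<in>I. ?pr (?A i \<inter> ?A j) > exp \<delta> * (?pr (?A i) * ?pr (?A j))}) \<le> 1 + S / \<delta>"
    if i: "i \<in> I" for i
  proof -
    have pair: "?pr (?A i \<inter> ?A j) = exp (sum W (T i \<inter> T j)) * (?pr (?A i) * ?pr (?A j))"
      if "j \<in> I" for j
    proof -
      have "?A i \<inter> ?A j = {\<omega>. \<forall>e\<in>T i \<union> T j. \<omega> e = t e}" by auto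
      then have "?pr (?A i \<inter> ?A j) = exp (- sum W (T i \<union> T j))"
        using prob[of "T i \<union> T j"] T i that by simp
      also have "sum W (T i \<union> T j) = sum W (T i) + sum W (T j) - sum W (T i \<inter> T j)"
        using sum.union_inter[OF finT[OF i] finT[OF that], of W] by simp
      finally show ?thesis
        using prob[OF T[OF i]] prob[OF T[OF that]] by (simp flip: exp_add)
    qed
    let ?bad = "{j\<in>I. j \<noteq> i \<and> \<delta> < sum W (T i \<inter> T j)}"
    have "real (card ?bad) * \<delta> = (\<Sum>j\<in>?bad. \<delta>)" by simp
    also have "\<dots> \<le> (\<Sum>j\<in>?bad. sum W (T i \<inter> T j))"
      by (intro sum_mono) auto
    also have "\<dots> = sum W (\<Union>j\<in>?bad. T i \<inter> T j)"
      using I finT triple[of _ i] by (intro sum.UNION_disjoint[symmetric]) auto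
    also have "\<dots> \<le> sum W (T i)"
      using finT[OF i] T[OF i] W_nonneg by (intro sum_mono2) auto
    also have "\<dots> \<le> S" by (rule S'[OF i])
    finally have bad: "real (card ?bad) \<le> S / \<delta>"
      using \<open>0 < \<delta>\<close> by (simp add: field_simps)
    have "{j\<in>I. ?pr (?A i \<inter> ?A j) > exp \<delta> * (?pr (?A i) * ?pr (?A j))} \<subseteq> insert i ?bad"
    proof
      fix j assume "j \<in> {j\<in>I. ?pr (?A i \<inter> ?A j) > exp \<delta> * (?pr (?A i) * ?pr (?A j))}"
      then have j: "j \<in> I" and lt: "exp \<delta> * (?pr (?A i) * ?pr (?A j)) <
          exp (sum W (T i \<inter> T j)) * (?pr (?A i) * ?pr (?A j))"
        using pair by auto
      have "0 < ?pr (?A i) * ?pr (?A j)"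
        using prob[OF T[OF i]] prob[OF T[OF j]] by simp
      with lt have "\<delta> < sum W (T i \<inter> T j)"
        by (simp add: mult_less_cancel_right)
      with j show "j \<in> insert i ?bad" by auto
    qed
    then have "card {j\<in>I. ?pr (?A i \<inter> ?A j) > exp \<delta> * (?pr (?A i) * ?pr (?A j))} \<le> card (insert i ?bad)"
      using I by (intro card_mono) auto
    also have "\<dots> \<le> Suc (card ?bad)"
      using I by (simp add: card_insert_if)
    finally show ?thesis using bad by linarith
  qed
qed (use I \<open>0 < \<delta>\<close> in auto)

section \<open>Isolated copies in the random graph\<close>

text \<open>Vertices are counted from \<open>1\<close>; block \<open>j\<close> consists of the \<open>k\<close> vertices from \<open>j * k + 1\<close>
on.\<close>

definition block :: "nat \<Rightarrow> nat \<Rightarrow> nat" where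
  "block k x = (x - 1) div k"

text \<open>One configuration serves for all blocks: a copy of \<open>H\<close> on each block and no edges between
different blocks. Block \<open>j\<close> carries an isolated copy of \<open>H\<close> when the graph agrees with the
target on all pairs that touch the block. As a pair has two ends, it touches at most two
blocks.\<close>

definition target :: "nat \<Rightarrow> (nat \<Rightarrow> nat \<Rightarrow> bool) \<Rightarrow> nat \<times> nat \<Rightarrow> bool" where
  "target k H = (\<lambda>(x, y). block k x = block k y \<and> H ((x - 1) mod k) ((y - 1) mod k))"

definition touching :: "nat \<Rightarrow> nat \<Rightarrow> nat \<Rightarrow> (nat \<times> nat) set" where
  "touching n k j = {e \<in> vertex_pairs n. block k (fst e) = j \<or> block k (snd e) = j}"

definition edge_pmf :: "(nat \<Rightarrow> real) \<Rightarrow> nat \<times> nat \<Rightarrow> bool pmf" where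
  "edge_pmf p = (\<lambda>(v, w). bernoulli_pmf (p (w - v)))"

definition log_loss :: "(nat \<Rightarrow> real) \<Rightarrow> nat \<Rightarrow> real" where
  "log_loss p n = (\<Sum>i=1..n. - ln (1 - p i))"

lemma card_block:
  assumes "0 < k"
  shows "card {x \<in> {1..n}. block k x = j} \<le> k"
proof -
  have "{x \<in> {1..n}. block k x = j} \<subseteq> {j * k + 1..j * k + k}"
  proof
    fix x assume "x \<in> {x \<in> {1..n}. block k x = j}"
    then have "1 \<le> x" and "(x - 1) div k = j" by (auto simp: block_def)
    then have "j * k \<le> x - 1" "x - 1 < j * k + k"
      using assms dividend_less_div_times[of k "x - 1"] by auto
    with \<open>1 \<le> x\<close> show "x \<in> {j * k + 1..j * k + k}"
      unfolding atLeastAtMost_iff by linarith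
  qed
  from card_mono[OF _ this] show ?thesis by simp
qed

context
  fixes p :: "nat \<Rightarrow> real"
  assumes p: "\<And>i. i \<ge> 1 \<Longrightarrow> 0 < p i \<and> p i < 1"
begin

lemma pmf_edge:
  assumes "e \<in> vertex_pairs n"
  shows "pmf (edge_pmf p e) b = (if b then p (snd e - fst e) else 1 - p (snd e - fst e))"
proof -
  have "1 \<le> snd e - fst e"
    using assms by (auto simp: vertex_pairs_def)
  with p have "0 \<le> p (snd e - fst e)" "p (snd e - fst e) \<le> 1"
    by (simp_all add: less_imp_le)
  then show ?thesis
    by (cases e; cases b) (simp_all add: edge_pmf_def)
qed

lemma pmf_edge_pos: "e \<in> vertex_pairs n \<Longrightarrow> 0 < pmf (edge_pmf p e) b"
  using p[of "snd e - fst e"] by (auto simp: pmf_edge) (auto simp: vertex_pairs_def)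

lemma loss_nonneg: "1 \<le> i \<Longrightarrow> 0 \<le> - ln (1 - p i)"
  using p[of i] by simp

text \<open>A pair is determined by one of its ends together with its length \<open>snd e - fst e\<close>. For a
fixed end every length occurs at most once, and there are at most \<open>k\<close> ends in a block.\<close>

lemma loss_at_endpoint:
  assumes "0 < k" and "T \<subseteq> vertex_pairs n" and "side \<in> {fst, snd}"
    and "\<And>e. e \<in> T \<Longrightarrow> block k (side e) = j"
  shows "(\<Sum>e\<in>T. - ln (1 - p (snd e - fst e))) \<le> k * log_loss p n"
proof -
  let ?h = "\<lambda>e. (side e, snd e - fst e)"
  let ?B = "{x \<in> {1..n}. block k x = j}"
  have "inj_on ?h T"
    using assms(2,3) by (auto simp: inj_on_def vertex_pairs_def)
  then have "(\<Sum>e\<in>T. - ln (1 - p (snd e - fst e))) = (\<Sum>z\<in>?h ` T. - ln (1 - p (snd z)))"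
    by (simp add: sum.reindex)
  also have "\<dots> \<le> (\<Sum>z\<in>?B \<times> {1..n}. - ln (1 - p (snd z)))"
  proof (rule sum_mono2)
    show "?h ` T \<subseteq> ?B \<times> {1..n}"
    proof
      fix z assume "z \<in> ?h ` T"
      then obtain e where "e \<in> T" "z = ?h e" by blast
      with assms show "z \<in> ?B \<times> {1..n}"
        using assms(4)[OF \<open>e \<in> T\<close>] by (auto simp: vertex_pairs_def)
    qed
  qed (use loss_nonneg in auto)
  also have "\<dots> = (\<Sum>x\<in>?B. \<Sum>i=1..n. - ln (1 - p i))"
    by (subst sum.cartesian_product) (simp add: split_def)
  also have "\<dots> = card ?B * log_loss p n"
    by (simp add: log_loss_def)
  also have "\<dots> \<le> k * log_loss p n"
    unfolding log_loss_def
    using card_block[OF assms(1), of n j] loss_nonneg by (intro mult_right_mono sum_nonneg) auto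
  finally show ?thesis .
qed

text \<open>The target asks for absence of almost all pairs touching block \<open>j\<close>; the absence of a pair
of length \<open>d\<close> costs \<open>- ln (1 - p d)\<close>. Only pairs inside the block can be asked to be present.
There are at most \<open>k\<^sup>2\<close> of them, all shorter than \<open>k\<close>, so they contribute a constant.\<close>

lemma sum_touching_le:
  assumes "0 < k"
  shows "(\<Sum>e\<in>touching n k j. - ln (pmf (edge_pmf p e) (target k H e))) \<le>
    2 * real k * log_loss p n + (real k)\<^sup>2 * (\<Sum>i=1..k. - ln (p i))"
proof -
  let ?T = "touching n k j"
  let ?l = "\<lambda>e. - ln (1 - p (snd e - fst e))"
  let ?M = "\<Sum>i=1..k. - ln (p i)"
  let ?in = "{e \<in> ?T. block k (fst e) = block k (snd e)}"
  have sub: "?T \<subseteq> vertex_pairs n" by (auto simp: touching_def)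
  have fin: "finite ?T" by (rule finite_subset[OF sub]) simp
  have l_nonneg: "0 \<le> ?l e" if "e \<in> ?T" for e
    using that sub loss_nonneg[of "snd e - fst e"] by (auto simp: vertex_pairs_def)
  have M_nonneg: "0 \<le> ?M"
    using p by (intro sum_nonneg) (auto simp: less_imp_le)
  have factor: "- ln (pmf (edge_pmf p e) (target k H e)) \<le> ?l e + (if e \<in> ?in then ?M else 0)"
    if e: "e \<in> ?T" for e
  proof (cases "target k H e")
    case True
    then have e_in: "e \<in> ?in"
      using e by (auto simp: target_def split: prod.splits)
    let ?d = "snd e - fst e"
    have "fst e < snd e" "1 \<le> fst e" and *: "(fst e - 1) div k = (snd e - 1) div k"
      using e e_in sub by (auto simp: vertex_pairs_def block_def)
    \<comment> \<open>Vertices of one block have equal quotients, so their distance is a difference of remainders.\<close>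
    have "?d = (snd e - 1) - (fst e - 1)"
      using \<open>fst e < snd e\<close> \<open>1 \<le> fst e\<close> by simp
    also have "\<dots> \<le> (snd e - 1) mod k"
      using * by (metis diff_le_mono2 div_mult_mod_eq div_times_less_eq_dividend le_diff_conv2
          add_diff_cancel_left' minus_mod_eq_div_mult minus_div_mult_eq_mod)
    also have "\<dots> < k" using assms by simp
    finally have d: "?d \<in> {1..k}" using \<open>fst e < snd e\<close> by simp
    have "- ln (p ?d) \<le> ?M"
      using p d by (intro member_le_sum) (auto simp: less_imp_le)
    with True e e_in l_nonneg[OF e] sub show ?thesis
      by (auto simp: pmf_edge)
  next
    case False
    with e sub M_nonneg show ?thesis by (auto simp: pmf_edge)
  qed
  have "card ?in \<le> card ({x \<in> {1..n}. block k x = j} \<times> {x \<in> {1..n}. block k x = j})"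
    by (intro card_mono) (auto simp: touching_def vertex_pairs_def)
  also have "\<dots> \<le> k\<^sup>2"
    using card_block[OF assms, of n j] by (simp add: card_cartesian_product power2_eq_square mult_le_mono)
  finally have card_in: "card ?in \<le> k\<^sup>2" .
  have "(\<Sum>e\<in>?T. ?l e) \<le> (\<Sum>e\<in>{e\<in>?T. block k (fst e) = j}. ?l e) + (\<Sum>e\<in>{e\<in>?T. block k (snd e) = j}. ?l e)"
  proof -
    have T: "?T = {e\<in>?T. block k (fst e) = j} \<union> {e\<in>?T. block k (snd e) = j}"
      by (auto simp: touching_def)
    have "(\<Sum>e\<in>?T. ?l e) \<le> (\<Sum>e\<in>{e\<in>?T. block k (fst e) = j} \<union> {e\<in>?T. block k (snd e) = j}. ?l e)"
      using T by simp
    also have "\<dots> \<le> (\<Sum>e\<in>{e\<in>?T. block k (fst e) = j}. ?l e) + (\<Sum>e\<in>{e\<in>?T. block k (snd e) = j}. ?l e)"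
      using fin l_nonneg sum.union_inter[of "{e\<in>?T. block k (fst e) = j}" "{e\<in>?T. block k (snd e) = j}" ?l]
        sum_nonneg[of "{e\<in>?T. block k (fst e) = j} \<inter> {e\<in>?T. block k (snd e) = j}" ?l]
      by auto
    finally show ?thesis .
  qed
  also have "\<dots> \<le> k * log_loss p n + k * log_loss p n"
    using assms sub
    by (intro add_mono loss_at_endpoint[where side = fst] loss_at_endpoint[where side = snd]) auto
  finally have T_le: "(\<Sum>e\<in>?T. ?l e) \<le> 2 * real k * log_loss p n" by simp
  have "(\<Sum>e\<in>?T. - ln (pmf (edge_pmf p e) (target k H e))) \<le> (\<Sum>e\<in>?T. ?l e + (if e \<in> ?in then ?M else 0))"
    by (intro sum_mono factor)
  also have "\<dots> = (\<Sum>e\<in>?T. ?l e) + card ?in * ?M"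
  proof -
    have "(\<Sum>e\<in>?T. if e \<in> ?in then ?M else 0) = (\<Sum>e\<in>?in. ?M)"
      by (rule sum.mono_neutral_cong_right) (use fin in auto)
    then show ?thesis by (simp only: sum.distrib sum_constant)
  qed
  also have "\<dots> \<le> 2 * real k * log_loss p n + (real k)\<^sup>2 * ?M"
    using T_le card_in M_nonneg by (intro add_mono mult_right_mono) (auto simp flip: of_nat_power)
  finally show ?thesis by simp
qed

lemma prob_no_block_le:
  assumes "0 < k" and "k \<le> n" and "0 < \<delta>"
    and S: "2 * real k * log_loss p n + (real k)\<^sup>2 * (\<Sum>i=1..k. - ln (p i)) \<le> S"
  shows "measure_pmf.prob (Pi_pmf (vertex_pairs n) False (edge_pmf p))
      (- (\<Union>j<n div k. {\<omega>. \<forall>e\<in>touching n k j. \<omega> e = target k H e})) \<le>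
    (exp \<delta> - 1) + (1 + S / \<delta>) / (real (n div k) * exp (- S))"
proof -
  have "0 < n div k"
    using assms by (simp add: div_greater_zero_iff)
  then have "measure_pmf.prob (Pi_pmf (vertex_pairs n) False (edge_pmf p))
      (- (\<Union>j\<in>{..<n div k}. {\<omega>. \<forall>e\<in>touching n k j. \<omega> e = target k H e})) \<le>
    (exp \<delta> - 1) + (1 + S / \<delta>) / (real (card {..<n div k}) * exp (- S))"
    by (intro prob_no_cylinder_le[where t = "target k H"])
      (use sum_touching_le[OF assms(1)] S pmf_edge_pos assms(3) in
        \<open>auto simp: touching_def intro: order_trans\<close>)
  then show ?thesis by simp
qed

text \<open>The cost \<open>S n\<close> of a block is \<open>o(ln n)\<close>, so eventually \<open>exp (- S n) \<ge> 1 / sqrt n\<close>. Against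
about \<open>n / k\<close> blocks this makes the error term of the second moment bound vanish, and \<open>\<delta>\<close> is
arbitrary.\<close>

lemma prob_no_block_tendsto_0:
  assumes "0 < k" and lim: "(\<lambda>n. ln (\<Prod>i=1..n. 1 - p i) / ln (real n)) \<longlonglongrightarrow> 0"
  shows "(\<lambda>n. measure_pmf.prob (Pi_pmf (vertex_pairs n) False (edge_pmf p))
      (- (\<Union>j<n div k. {\<omega>. \<forall>e\<in>touching n k j. \<omega> e = target k H e}))) \<longlonglongrightarrow> 0"
    (is "?f \<longlonglongrightarrow> 0")
proof -
  define S where "S n = 2 * real k * log_loss p n + (real k)\<^sup>2 * (\<Sum>i=1..k. - ln (p i))" for n
  have "ln (\<Prod>i=1..n. 1 - p i) = - log_loss p n" for n
  proof -
    have "p i \<noteq> 1" "p i < 1" if "i \<in> {1..n}" for i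
      using p[of i] that by auto
    then show ?thesis
      by (subst ln_prod) (auto simp: log_loss_def sum_negf)
  qed
  with lim have "(\<lambda>n. - (- log_loss p n / ln (real n))) \<longlonglongrightarrow> - 0"
    by (intro tendsto_minus) simp
  then have loss: "(\<lambda>n. log_loss p n / ln (real n)) \<longlonglongrightarrow> 0" by simp
  have "(\<lambda>n. 1 / ln (real n)) \<longlonglongrightarrow> 0" by real_asymp
  from tendsto_add[OF tendsto_mult_right_zero[OF loss, of "2 * real k"]
      tendsto_mult_right_zero[OF this, of "(real k)\<^sup>2 * (\<Sum>i=1..k. - ln (p i))"]]
  have "(\<lambda>n. S n / ln (real n)) \<longlonglongrightarrow> 0"
    by (simp add: S_def add_divide_distrib)
  then have "\<forall>\<^sub>F n in sequentially. S n / ln (real n) < 1 / 2"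
    by (rule order_tendstoD) simp
  then have S_le: "\<forall>\<^sub>F n in sequentially. S n \<le> ln (real n) / 2"
    using eventually_gt_at_top[of 1] by eventually_elim (simp add: field_simps)
  show ?thesis
  proof (rule order_tendstoI)
    fix \<epsilon> :: real assume "0 < \<epsilon>"
    \<comment> \<open>Makes the part \<open>exp \<delta> - 1\<close> of the bound equal to half of \<open>\<epsilon>\<close>.\<close>
    define \<delta> where "\<delta> = ln (1 + \<epsilon> / 2)"
    have \<delta>: "0 < \<delta>" "exp \<delta> - 1 = \<epsilon> / 2"
      using \<open>0 < \<epsilon>\<close> by (auto simp: \<delta>_def)
    have "(\<lambda>n. (1 + ln (real n) / 2 / \<delta>) / (real n / (2 * real k) * exp (- (ln (real n) / 2)))) \<longlonglongrightarrow> 0"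
      using \<open>0 < \<delta>\<close> \<open>0 < k\<close> by real_asymp
    then have "\<forall>\<^sub>F n in sequentially.
        (1 + ln (real n) / 2 / \<delta>) / (real n / (2 * real k) * exp (- (ln (real n) / 2))) < \<epsilon> / 2"
      by (rule order_tendstoD) (use \<open>0 < \<epsilon>\<close> in simp)
    with S_le eventually_ge_at_top[of "2 * k"] show "\<forall>\<^sub>F n in sequentially. ?f n < \<epsilon>"
    proof eventually_elim
      case (elim n)
      have n: "0 < n" "k \<le> n" using elim assms(1) by auto
      \<comment> \<open>Rounding costs at most a factor \<open>2\<close> in the number of blocks when \<open>2 * k \<le> n\<close>.\<close>
      have "n < (n div k + 1) * k"
        using dividend_less_div_times[OF assms(1), of n] by simp
      then have "real n < (real (n div k) + 1) * real k"
        by (metis of_nat_1 of_nat_add of_nat_less_iff of_nat_mult)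
      moreover have "2 * real k \<le> real n"
        using elim(2) by linarith
      ultimately have "real n / (2 * real k) \<le> real (n div k)"
        using assms(1) by (simp add: field_simps)
      then have "(1 + ln (real n) / 2 / \<delta>) / (real (n div k) * exp (- (ln (real n) / 2))) \<le>
          (1 + ln (real n) / 2 / \<delta>) / (real n / (2 * real k) * exp (- (ln (real n) / 2)))"
        using n \<delta> assms(1) by (intro divide_left_mono mult_right_mono mult_pos_pos)
          (auto simp: div_greater_zero_iff intro!: add_nonneg_nonneg divide_nonneg_nonneg)
      with elim(3) prob_no_block_le[OF assms(1) n(2) \<delta>(1) elim(1)[unfolded S_def], of H] \<delta>(2)
      show ?case by linarith
    qed
  next
    fix \<epsilon> :: real assume "\<epsilon> < 0"
    then show "\<forall>\<^sub>F n in sequentially. \<epsilon> < ?f n"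
      by (intro always_eventually allI) (meson less_le_trans measure_nonneg)
  qed
qed

end

text \<open>Pairs that are not vertex pairs, in particular loops, are excluded separately, since no
cylinder event speaks about them.\<close>

lemma isolated_copy_on_block:
  assumes h: "bij_betw h {..<k} C" and sym: "\<And>x y. K x y \<longleftrightarrow> K y x" and irrefl: "\<And>x. \<not> K x x"
    and j: "j < n div k"
    and outside: "\<And>e. e \<notin> vertex_pairs n \<Longrightarrow> \<not> \<omega> e"
    and inside: "\<forall>e\<in>touching n k j. \<omega> e = target k (\<lambda>a b. K (h a) (h b)) e"
  shows "isolated_copy C K (\<lambda>x. j * k + 1 + the_inv_into {..<k} h x) {1..n}
    (\<lambda>v w. \<omega> (min v w, max v w))"
proof -
  let ?g = "the_inv_into {..<k} h"
  let ?e = "\<lambda>x. j * k + 1 + ?g x"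
  have k: "0 < k" using j by (cases k) auto
  have inj: "inj_on h {..<k}" using h by (simp add: bij_betw_def)
  have g: "?g x < k" "h (?g x) = x" if "x \<in> C" for x
    using h that bij_betw_the_inv_into[OF h] f_the_inv_into_f_bij_betw[OF h, of x]
    by (auto dest: bij_betwE)
  have block_e: "block k (?e x) = j" "(?e x - 1) mod k = ?g x" if "x \<in> C" for x
    using g[OF that] by (auto simp: block_def)
  have "(j + 1) * k \<le> n"
    using j by (metis Suc_eq_plus1 Suc_leI div_times_less_eq_dividend le_trans mult_le_mono1)
  then have e_in: "?e x \<in> {1..n}" if "x \<in> C" for x
    using g[OF that] by (simp add: algebra_simps)
  have "?e x = ?e y \<longleftrightarrow> x = y" if "x \<in> C" "y \<in> C" for x y
    using g(2)[OF that(1)] g(2)[OF that(2)] by (metis add_left_cancel)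
  then have "inj_on ?e C" by (auto simp: inj_on_def)
  moreover have "\<omega> (min (?e x) z, max (?e x) z) \<longleftrightarrow> (\<exists>y\<in>C. z = ?e y \<and> K x y)"
    if x: "x \<in> C" and z: "z \<in> {1..n}" for x z
  proof (cases "z = ?e x")
    case True
    then have "(min (?e x) z, max (?e x) z) \<notin> vertex_pairs n"
      by (simp add: vertex_pairs_def)
    moreover have "\<not> (\<exists>y\<in>C. z = ?e y \<and> K x y)"
      using True irrefl g x by (metis add_left_cancel)
    ultimately show ?thesis using outside by blast
  next
    case False
    let ?z = "(z - 1) mod k"
    have "(min (?e x) z, max (?e x) z) \<in> touching n k j"
      using False e_in[OF x] z block_e[OF x]
      by (auto simp: touching_def vertex_pairs_def min_def max_def)
    then have "\<omega> (min (?e x) z, max (?e x) z) \<longleftrightarrow>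
        target k (\<lambda>a b. K (h a) (h b)) (min (?e x) z, max (?e x) z)"
      using inside by blast
    also have "\<dots> \<longleftrightarrow> block k z = j \<and> K x (h ?z)"
      using block_e[OF x] g[OF x] sym by (auto simp: target_def min_def max_def)
    also have "\<dots> \<longleftrightarrow> (\<exists>y\<in>C. z = ?e y \<and> K x y)"
    proof
      assume *: "block k z = j \<and> K x (h ?z)"
      have z_lt: "?z < k" using k by simp
      then have hz: "h ?z \<in> C" and ghz: "?g (h ?z) = ?z"
        using h by (auto dest: bij_betwE simp: the_inv_into_f_f[OF inj])
      have "z - 1 = j * k + ?z"
        using * div_mult_mod_eq[of "z - 1" k] by (simp add: block_def)
      with z have "z = j * k + 1 + ?z" by simp
      then have "z = ?e (h ?z)"
        unfolding ghz .
      with hz * show "\<exists>y\<in>C. z = ?e y \<and> K x y" by blast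
    next
      assume "\<exists>y\<in>C. z = ?e y \<and> K x y"
      then obtain y where y: "y \<in> C" "z = ?e y" "K x y" by blast
      then show "block k z = j \<and> K x (h ?z)"
        using block_e[OF y(1)] g(2)[OF y(1)] by simp
    qed
    finally show ?thesis .
  qed
  ultimately show ?thesis
    using e_in by (auto simp: isolated_copy_def)
qed

text \<open>Any enumeration of \<open>C\<close> turns \<open>K\<close> into a configuration on a block of \<open>card C\<close> vertices;
agreement with the target around one block then is an isolated copy.\<close>

theorem prob_isolated_copy_tendsto_1:
  fixes p :: "nat \<Rightarrow> real" and K :: "'a \<Rightarrow> 'a \<Rightarrow> bool"
  assumes p: "\<And>i. i \<ge> 1 \<Longrightarrow> 0 < p i \<and> p i < 1"
    and lim: "(\<lambda>n. ln (\<Prod>i=1..n. 1 - p i) / ln (real n)) \<longlonglongrightarrow> 0"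
    and C: "finite C" "C \<noteq> {}" and sym: "\<And>x y. K x y \<longleftrightarrow> K y x" and irrefl: "\<And>x. \<not> K x x"
  shows "(\<lambda>n. measure_pmf.prob (random_graph n p) {E. \<exists>e. isolated_copy C K e {1..n} E}) \<longlonglongrightarrow> 1"
proof -
  let ?k = "card C"
  obtain h where "bij_betw h {0..<?k} C"
    using ex_bij_betw_nat_finite[OF C(1)] by blast
  then have h: "bij_betw h {..<?k} C" by (simp add: atLeast0LessThan)
  have k: "0 < ?k" using C by (simp add: card_gt_0_iff)
  let ?P = "\<lambda>n. Pi_pmf (vertex_pairs n) False (edge_pmf p)"
  let ?none = "\<lambda>n. - (\<Union>j<n div ?k. {\<omega>. \<forall>e\<in>touching n ?k j. \<omega> e = target ?k (\<lambda>a b. K (h a) (h b)) e})"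
  let ?copy = "\<lambda>n. measure_pmf.prob (random_graph n p) {E. \<exists>e. isolated_copy C K e {1..n} E}"
  have lower: "1 - measure_pmf.prob (?P n) (?none n) \<le> ?copy n" for n
  proof -
    let ?G = "\<lambda>\<omega> v w. \<omega> (min v w, max v w)"
    have "1 - measure_pmf.prob (?P n) (?none n) = measure_pmf.prob (?P n) (- ?none n)"
      using measure_pmf.prob_compl[of "?none n" "?P n"] by (simp add: Compl_eq_Diff_UNIV)
    also have "\<dots> = measure_pmf.prob (?P n) (- ?none n \<inter> set_pmf (?P n))"
      by (simp add: measure_Int_set_pmf)
    also have "\<dots> \<le> measure_pmf.prob (?P n) {\<omega>. \<exists>e. isolated_copy C K e {1..n} (?G \<omega>)}"
    proof (rule measure_pmf.finite_measure_mono)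
      show "- ?none n \<inter> set_pmf (?P n) \<subseteq> {\<omega>. \<exists>e. isolated_copy C K e {1..n} (?G \<omega>)}"
      proof
        fix \<omega> assume \<omega>: "\<omega> \<in> - ?none n \<inter> set_pmf (?P n)"
        then obtain j where "j < n div ?k"
          and "\<forall>e\<in>touching n ?k j. \<omega> e = target ?k (\<lambda>a b. K (h a) (h b)) e"
          by auto
        moreover have "\<not> \<omega> e" if "e \<notin> vertex_pairs n" for e
          using \<omega> that set_Pi_pmf_subset[OF finite_vertex_pairs, of n False "edge_pmf p"] by blast
        ultimately have "isolated_copy C K (\<lambda>x. j * ?k + 1 + the_inv_into {..<?k} h x) {1..n} (?G \<omega>)"
          by (intro isolated_copy_on_block[OF h sym irrefl]) auto
        then show "\<omega> \<in> {\<omega>. \<exists>e. isolated_copy C K e {1..n} (?G \<omega>)}" by blast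
      qed
    qed simp
    also have "\<dots> = ?copy n"
      by (simp add: random_graph_def vimage_def flip: edge_pmf_def)
    finally show ?thesis .
  qed
  have upper: "?copy n \<le> 1" for n
    by (rule measure_pmf.prob_le_1)
  have "(\<lambda>n. 1 - measure_pmf.prob (?P n) (?none n)) \<longlonglongrightarrow> 1 - 0"
    by (intro tendsto_diff tendsto_const prob_no_block_tendsto_0[OF p k lim])
  then have "(\<lambda>n. 1 - measure_pmf.prob (?P n) (?none n)) \<longlonglongrightarrow> 1"
    by (simp only: diff_zero)
  from tendsto_sandwich[OF always_eventually[OF allI[OF lower]] always_eventually[OF allI[OF upper]]
      this tendsto_const]
  show ?thesis .
qed

section \<open>Computing the diagonal sentence\<close>

lemma rec_eval_Proj: "i < length xs \<Longrightarrow> xs ! i = y \<Longrightarrow> rec_eval (Proj i) xs y"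
  using rec_eval.proj by blast

lemma rec_eval_Comp_unary:
  "rec_eval g xs y \<Longrightarrow> rec_eval f [y] z \<Longrightarrow> rec_eval (Comp f [g]) xs z"
  by (rule rec_eval.comp[of _ _ "[y]"]) auto

lemma rec_eval_Comp_binary:
  "rec_eval g xs y \<Longrightarrow> rec_eval h xs y' \<Longrightarrow> rec_eval f [y, y'] z \<Longrightarrow> rec_eval (Comp f [g, h]) xs z"
  by (rule rec_eval.comp[of _ _ "[y, y']"]) auto

primrec const_recf :: "nat \<Rightarrow> recf" where
  "const_recf 0 = Zero"
| "const_recf (Suc n) = Comp Succ [const_recf n]"

lemma rec_eval_const: "rec_eval (const_recf n) xs n"
  by (induction n) (auto intro: rec_eval.zero rec_eval_Comp_unary rec_eval.succ)

definition add_recf :: recf where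
  "add_recf = PrimRec (Proj 0) (Comp Succ [Proj 1])"

lemma rec_eval_add: "rec_eval add_recf [m, n] (m + n)"
  unfolding add_recf_def
proof (induction m)
  case 0
  show ?case by (intro rec_eval.primrec_zero rec_eval_Proj) simp_all
next
  case (Suc m)
  have "rec_eval (Comp Succ [Proj 1]) [m, m + n, n] (Suc m + n)"
    by (auto intro!: rec_eval_Comp_unary[where y = "m + n"] rec_eval_Proj rec_eval.succ)
  with Suc show ?case by (rule rec_eval.primrec_suc)
qed

definition triangle_recf :: recf where
  "triangle_recf = PrimRec Zero (Comp Succ [Comp add_recf [Proj 1, Proj 0]])"

lemma rec_eval_triangle: "rec_eval triangle_recf [n] (triangle n)"
  unfolding triangle_recf_def
proof (induction n)
  case 0
  show ?case by (auto intro: rec_eval.primrec_zero rec_eval.zero)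
next
  case (Suc n)
  have "rec_eval (Comp Succ [Comp add_recf [Proj 1, Proj 0]]) [n, triangle n] (Suc (triangle n + n))"
    by (intro rec_eval_Comp_unary[where y = "triangle n + n"] rec_eval.succ
        rec_eval_Comp_binary[OF _ _ rec_eval_add] rec_eval_Proj) auto
  with Suc show ?case by (auto intro: rec_eval.primrec_suc)
qed

definition pair_recf :: "recf \<Rightarrow> recf \<Rightarrow> recf" where
  "pair_recf a b = Comp add_recf [Comp triangle_recf [Comp add_recf [a, b]], a]"

lemma rec_eval_pair:
  "rec_eval a xs m \<Longrightarrow> rec_eval b xs n \<Longrightarrow> rec_eval (pair_recf a b) xs (prod_encode (m, n))"
  unfolding pair_recf_def prod_encode_def
  by (auto intro!: rec_eval_Comp_binary[OF _ _ rec_eval_add] rec_eval_Comp_unary[OF _ rec_eval_triangle])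

definition ex_recf :: "nat \<Rightarrow> recf \<Rightarrow> recf" where
  "ex_recf x r = pair_recf (const_recf 4) (pair_recf (const_recf x) r)"

definition conj_recf :: "fm \<Rightarrow> recf \<Rightarrow> recf" where
  "conj_recf \<phi> r = pair_recf (const_recf 3) (pair_recf (const_recf (code_fm \<phi>)) r)"

lemma rec_eval_ex: "rec_eval r xs (code_fm \<phi>) \<Longrightarrow> rec_eval (ex_recf x r) xs (code_fm (Ex x \<phi>))"
  by (auto simp: ex_recf_def intro!: rec_eval_pair rec_eval_const)

lemma rec_eval_conj:
  "rec_eval r xs (code_fm \<psi>) \<Longrightarrow> rec_eval (conj_recf \<phi> r) xs (code_fm (Conj \<phi> \<psi>))"
  by (auto simp: conj_recf_def intro!: rec_eval_pair rec_eval_const)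

text \<open>The operations on codes that correspond to \<open>shift_fm\<close> and \<open>at_zero_fm\<close>, as combinators on
recursive functions that output codes.\<close>

definition shift_recf :: "recf \<Rightarrow> recf" where
  "shift_recf r = ex_recf 4 (conj_recf (Adj 0 4) (conj_recf (succ_fm 3 4)
     (ex_recf 3 (conj_recf (Eq 3 4) r))))"

definition at_zero_recf :: "recf \<Rightarrow> recf" where
  "at_zero_recf r = ex_recf 0 (ex_recf 1 (ex_recf 2 (conj_recf linear_fm
     (ex_recf 3 (conj_recf (Adj 0 3) (conj_recf (zero_fm 3) r))))))"

text \<open>On input \<open>m\<close> the recursion shifts \<open>m\<close> times, beginning with the formula whose code is \<open>m\<close>.
The two occurrences of the input are its two roles, as code of the formula and as argument.\<close>

definition diagonal_recf :: recf where
  "diagonal_recf =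
     at_zero_recf (Comp (PrimRec (Proj 0) (shift_recf (Proj 1))) [Proj 0, Proj 0])"

lemma rec_eval_shift:
  "rec_eval r xs (code_fm \<phi>) \<Longrightarrow> rec_eval (shift_recf r) xs (code_fm (shift_fm \<phi>))"
  unfolding shift_recf_def shift_fm_def num_ex_def by (intro rec_eval_ex rec_eval_conj)

lemma rec_eval_at_zero:
  "rec_eval r xs (code_fm \<phi>) \<Longrightarrow> rec_eval (at_zero_recf r) xs (code_fm (at_zero_fm \<phi>))"
  unfolding at_zero_recf_def at_zero_fm_def num_ex_def by (intro rec_eval_ex rec_eval_conj)

lemma rec_eval_shift_power:
  "rec_eval (PrimRec (Proj 0) (shift_recf (Proj 1))) [m, code_fm \<phi>] (code_fm ((shift_fm ^^ m) \<phi>))"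
proof (induction m)
  case 0
  show ?case by (intro rec_eval.primrec_zero rec_eval_Proj) simp_all
next
  case (Suc m)
  have "rec_eval (shift_recf (Proj 1)) [m, code_fm ((shift_fm ^^ m) \<phi>), code_fm \<phi>]
      (code_fm (shift_fm ((shift_fm ^^ m) \<phi>)))"
    by (intro rec_eval_shift rec_eval_Proj) auto
  with Suc show ?case by (auto intro: rec_eval.primrec_suc)
qed

lemma rec_eval_diagonal:
  "rec_eval diagonal_recf [code_fm \<phi>] (code_fm (instance_fm \<phi> (code_fm \<phi>)))"
  unfolding diagonal_recf_def instance_fm_def
  by (intro rec_eval_at_zero rec_eval_Comp_binary[OF _ _ rec_eval_shift_power] rec_eval_Proj) auto

section \<open>Undecidability\<close>

theorem theorem9:
  fixes p :: "nat \<Rightarrow> real"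
  assumes "\<And>i. i \<ge> 1 \<Longrightarrow> 0 < p i \<and> p i < 1"
    and "(\<lambda>n. ln (\<Prod>i=1..n. 1 - p i) / ln (real n)) \<longlonglongrightarrow> 0"
  shows "\<not> (\<exists>f. decides_limit f p)"
proof
  assume "\<exists>f. decides_limit f p"
  then obtain f where f: "decides_limit f p" by blast
  define F where "F = Comp f [diagonal_recf]"
  define m where "m = code_fm (vanishes_fm F)"
  define \<psi> where "\<psi> = instance_fm (vanishes_fm F) m"
  have diagonal: "rec_eval diagonal_recf [m] (code_fm \<psi>)"
    unfolding \<psi>_def m_def by (rule rec_eval_diagonal)
  have sentence: "sentence \<psi>"
    unfolding \<psi>_def by (rule sentence_instance_fm[OF free_vars_vanishes_fm])
  show False
  proof (cases "rec_eval F [m] 0")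
    case True
    \<comment> \<open>Then \<open>f\<close> answers \<open>0\<close> on \<open>\<psi>\<close>, although \<open>\<psi>\<close> is true wherever a large gadget graph is isolated.\<close>
    then obtain y where "rec_eval diagonal_recf [m] y" "rec_eval f [y] 0"
      unfolding F_def by (auto elim!: rec_eval_CompE simp: list_all2_Cons1)
    with diagonal have f0: "rec_eval f [code_fm \<psi>] 0"
      using rec_eval_deterministic by blast
    obtain N where N: "\<And>e (V :: nat set) E.
        isolated_copy (gadgets N) gadget_adj e V E \<Longrightarrow> models V E \<psi>"
      using models_instance_fm_if_rec_eval[OF True] unfolding \<psi>_def by metis
    let ?copy = "\<lambda>n. measure_pmf.prob (random_graph n p)
      {E. \<exists>e. isolated_copy (gadgets N) gadget_adj e {1..n} E}"
    have lower: "?copy n \<le> Prob n p \<psi>" for n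
      unfolding Prob_def by (rule measure_pmf.finite_measure_mono) (use N in auto)
    have upper: "Prob n p \<psi> \<le> 1" for n
      by (simp add: Prob_def)
    have "gadgets N \<noteq> {}"
      using mem_gadgets(1) by blast
    then have "?copy \<longlonglongrightarrow> 1"
      by (intro prob_isolated_copy_tendsto_1[OF assms finite_gadgets _ gadget_adj_sym gadget_adj_irrefl])
    from tendsto_sandwich[OF always_eventually[OF allI[OF lower]]
        always_eventually[OF allI[OF upper]] this tendsto_const]
    have "(\<lambda>n. Prob n p \<psi>) \<longlonglongrightarrow> 1" .
    with f sentence have "rec_eval f [code_fm \<psi>] 1"
      by (simp add: decides_limit_def)
    with f0 show False
      using rec_eval_deterministic by fastforce
  next
    case False
    \<comment> \<open>Then \<open>\<psi>\<close> fails in every nonempty finite graph, which obliges \<open>f\<close> to answer \<open>0\<close> on it.\<close>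
    have "Prob n p \<psi> = 0" if "1 \<le> n" for n
    proof -
      have "\<not> models {1..n} E \<psi>" for E
        using rec_eval_if_models_instance_fm[of "{1..n}" E F m] that False
        unfolding \<psi>_def by auto
      then show ?thesis by (simp add: Prob_def)
    qed
    then have "(\<lambda>n. Prob n p \<psi>) \<longlonglongrightarrow> 0"
      by (intro tendsto_eventually eventually_sequentiallyI[of 1])
    with f sentence have "rec_eval f [code_fm \<psi>] 0"
      by (simp add: decides_limit_def)
    with diagonal have "rec_eval F [m] 0"
      unfolding F_def by (rule rec_eval_Comp_unary)
    with False show False ..
  qed
qed

end
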